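(* Let $T>0$ and $L\in(0,1)$, and let $(\theta_j^T)_{j\in\mathbb{N}^*}$ be a sequence of $L^2(0,T)$ biorthogonal to the sequence of functions $(t\mapsto e^{-j^2t})_{j\in\mathbb{N}^*}$. Let $\chi_{\omega^*}\in\mathcal{U}_L$ be the unique solution of $$\sup_{\chi_{\omega}\in\mathcal{U}_{L}}\ \inf_{j\in\mathbb{N}^*}\ \frac{e^{2j^2T}}{\int_{0}^T\theta_j^T(t)^2\, dt} \int_{\omega}\sin^2(jx)\, dx ,$$ and, for every $N\in\mathbb{N}^*$, let $\chi_{\omega^N}\in\mathcal{U}_L$ be the unique solution of the truncated problem $$\sup_{\chi_{\omega}\in\mathcal{U}_{L}}\ \inf_{1\leq j\leq N}\ \frac{e^{2j^2T}}{\int_{0}^T\theta_j^T(t)^2\, dt} \int_{\omega}\sin^2(jx)\, dx .$$ Then there exists $N_0\in\mathbb{N}^*$ such that $\omega^*=\omega^N$ for every $N\geq N_0$. Furthermore, $N_0\leq\widetilde N_0$, where $\widetilde N_0$ is the first integer (which exists and is finite) such that $$\forall j\geq\widetilde N_0,\qquad \|\theta_j^T\|_{L^2(0,T)}^2\leq\frac{e^2\left(\pi L-\sin(\pi L)\right)}{128}\,e^{2T(j^2-1)} .$$ As a result, $N_0$ is equal to $1$ if $T$ is large enough.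
   Context: $\mathbb{N}^*=\{1,2,3,\dots\}$. The class of admissible domains is $\mathcal{U}_L=\{\chi_\omega\in L^\infty(0,\pi;\{0,1\}) \mid \omega\subset(0,\pi) \text{ Lebesgue measurable},\ |\omega|=L\pi\}$, where $\chi_\omega$ is the characteristic function of $\omega$ and $|\omega|$ is its Lebesgue measure. A solution is an element of $\mathcal{U}_L$ at which the supremum is attained; the paper establishes that each of the two problems has a unique solution. Uniqueness and equality of sets are understood up to sets of zero measure. Biorthogonality means $\int_0^T e^{-j^2t}\theta_k^T(t)\,dt=\delta_{jk}$ for all $j,k\in\mathbb{N}^*$, where $\delta_{jk}=1$ if $j=k$ and $0$ otherwise; the existence of such a sequence follows from the Müntz-Szász theorem.
   Formalization: Biorthogonal sequences are not unique, and for some of them no finite Ñ_0 exists or N_0=1 fails for all T; so N_0≤Ñ_0 is proved for every sequence for which Ñ_0 exists, and existence of Ñ_0 and N_0=1 for large T are proved for the biorthogonal sequence of minimal norm. *)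

theory Defs
  imports "HOL-Analysis.Analysis"
begin

definition L2 :: "real \<Rightarrow> (real \<Rightarrow> real) set" where
  "L2 T = {f. f \<in> borel_measurable (lebesgue_on {0<..<T})
            \<and> integrable (lebesgue_on {0<..<T}) (\<lambda>t. (f t)^2)}"

definition L2_norm :: "real \<Rightarrow> (real \<Rightarrow> real) \<Rightarrow> real" where
  "L2_norm T f = sqrt (\<integral>t. (f t)^2 \<partial>lebesgue_on {0<..<T})"

text \<open>All sequences are indexed by the positive integers; the value at index 0 is irrelevant.\<close>

definition biorthogonal :: "real \<Rightarrow> (nat \<Rightarrow> real \<Rightarrow> real) \<Rightarrow> bool" where
  "biorthogonal T \<theta> \<longleftrightarrow>
     (\<forall>k\<ge>1. \<theta> k \<in> L2 T) \<and>
     (\<forall>j\<ge>1. \<forall>k\<ge>1. (\<integral>t. exp (- ((real j)^2 * t)) * \<theta> k t \<partial>lebesgue_on {0<..<T})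
                    = (if j = k then 1 else 0))"

text \<open>The exponentials do not span a dense subspace of \<open>L2 T\<close>, so biorthogonal sequences are far
  from unique: any element of the orthogonal complement may be added to each term, and the norms can
  be made as large as one likes.  The Muentz-Szasz theorem provides the one whose terms have minimal
  norm (\<open>\<theta> j\<close> is the component of \<open>t \<mapsto> exp (- j^2 * t)\<close> orthogonal to the closed
  span of the other exponentials, divided by its squared norm).\<close>

definition minimal_biorthogonal :: "real \<Rightarrow> (nat \<Rightarrow> real \<Rightarrow> real) \<Rightarrow> bool" where
  "minimal_biorthogonal T \<theta> \<longleftrightarrow>
     biorthogonal T \<theta> \<and>
     (\<forall>\<eta>. biorthogonal T \<eta> \<longrightarrow> (\<forall>j\<ge>1. L2_norm T (\<theta> j) \<le> L2_norm T (\<eta> j)))"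

text \<open>A characteristic function is represented by the underlying set, and equality of
  characteristic functions almost everywhere by \<open>ae_eq\<close>.\<close>

definition admissible :: "real \<Rightarrow> real set set" where
  "admissible L = {\<omega>. \<omega> \<subseteq> {0<..<pi} \<and> \<omega> \<in> sets lebesgue \<and> measure lebesgue \<omega> = L * pi}"

definition ae_eq :: "real set \<Rightarrow> real set \<Rightarrow> bool" where
  "ae_eq \<omega> \<omega>' \<longleftrightarrow> (AE x in lebesgue. x \<in> \<omega> \<longleftrightarrow> x \<in> \<omega>')"

text \<open>The index set \<open>I\<close> is \<open>{1..}\<close> for the full problem and \<open>{1..N}\<close> for the truncated one.
  The terms are nonnegative, so the infimum is a genuine one.\<close>

definition criterion :: "real \<Rightarrow> (nat \<Rightarrow> real \<Rightarrow> real) \<Rightarrow> nat set \<Rightarrow> real set \<Rightarrow> real" where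
  "criterion T \<theta> I \<omega> =
     (INF j\<in>I. exp (2 * (real j)^2 * T) / (\<integral>t. (\<theta> j t)^2 \<partial>lebesgue_on {0<..<T})
               * (\<integral>x\<in>\<omega>. (sin (real j * x))^2 \<partial>lebesgue))"

text \<open>For \<open>1 \<in> I\<close> the criterion is bounded above on \<open>admissible L\<close> by \<open>pi\<close> times the weight of
  index 1, so the supremum below is a genuine one.\<close>

definition solution ::
    "real \<Rightarrow> real \<Rightarrow> (nat \<Rightarrow> real \<Rightarrow> real) \<Rightarrow> nat set \<Rightarrow> real set \<Rightarrow> bool" where
  "solution L T \<theta> I \<omega> \<longleftrightarrow>
     \<omega> \<in> admissible L \<and>
     criterion T \<theta> I \<omega> = (SUP \<omega>'\<in>admissible L. criterion T \<theta> I \<omega>')"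

definition unique_solution ::
    "real \<Rightarrow> real \<Rightarrow> (nat \<Rightarrow> real \<Rightarrow> real) \<Rightarrow> nat set \<Rightarrow> real set \<Rightarrow> bool" where
  "unique_solution L T \<theta> I \<omega> \<longleftrightarrow>
     solution L T \<theta> I \<omega> \<and> (\<forall>\<omega>'. solution L T \<theta> I \<omega>' \<longrightarrow> ae_eq \<omega>' \<omega>)"

definition norm_bound_from :: "real \<Rightarrow> real \<Rightarrow> (nat \<Rightarrow> real \<Rightarrow> real) \<Rightarrow> nat \<Rightarrow> bool" where
  "norm_bound_from L T \<theta> n \<longleftrightarrow>
     1 \<le> n \<and>
     (\<forall>j\<ge>n. (L2_norm T (\<theta> j))^2
        \<le> exp 2 * (pi * L - sin (pi * L)) / 128 * exp (2 * T * ((real j)^2 - 1)))"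

end

theory Submission
  imports Defs "HOL-Complex_Analysis.Cauchy_Integral_Formula"
begin

text \<open>The proof has two independent halves.

The first half concerns truncation. Both criteria are infima of the terms \<open>weighted_energy T \<theta> \<omega> j\<close>. As soon
as every term with \<open>j > N\<close> dominates the first one, whatever the admissible set, these terms do not influence the infimum, the two
criteria coincide, and so do their unique maximisers (\<open>truncated_solution_eq\<close>). The domination holds for every
\<open>j\<close> beyond the threshold of \<open>norm_bound_from\<close> (\<open>weighted_energy_1_le\<close>): the integral of \<open>sin\<^sup>2 (j x)\<close> over a set
of measure \<open>L * pi\<close> is at least \<open>(pi * L - sin (pi * L)) / 2\<close> for all \<open>j\<close> (\<open>sin_square_integral_lower_bound\<close>),
while the first term is bounded above because \<open>\<theta> 1\<close>, having inner product \<open>1\<close> with a function of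
norm less than \<open>1\<close>, cannot have small norm (\<open>biorthogonal_norm_lower_bound\<close>).

The second half concerns the norms. That the threshold exists for a family of minimal norm, and that it is at most \<open>2\<close> for large \<open>T\<close>,
follows by comparison with an explicit biorthogonal family (\<open>biorthogonal_family_exists\<close>) with
\<open>\<parallel>\<eta> j\<parallel>\<^sup>2 \<le> A * exp (2 * pi * j + T * j\<^sup>2)\<close>. Biorthogonality says that the Laplace transform of \<open>\<eta> j\<close> over
\<open>(0, T)\<close> equals \<open>1\<close> at \<open>j\<^sup>2\<close> and \<open>0\<close> at \<open>k\<^sup>2\<close> for all other \<open>k \<ge> 1\<close>. The entire function
\<open>P s = sin (pi * sqrt s) / (pi * sqrt s) / (1 - s / j\<^sup>2)\<close> vanishes at exactly these \<open>k\<^sup>2\<close>. If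
\<open>h\<close> is smooth and flat at the endpoints \<open>0\<close> and \<open>T\<close>, then \<open>P D h\<close>, with \<open>D\<close> the derivative, has Laplace transform
\<open>P\<close> times that of \<open>h\<close>, so a multiple of \<open>P D h\<close> is the required \<open>\<eta> j\<close>. The series \<open>P D h\<close> converges
because the coefficients of \<open>P\<close> decay like \<open>1 / (2 m)!\<close>, whereas the derivatives of
\<open>h t = exp (- 1 / t\<^sup>2 - 1 / (T - t)\<^sup>2)\<close> grow only like \<open>m! ^ (3/2)\<close>, up to geometric factors. For large
\<open>T\<close> one compares with the family for the interval \<open>(0, 1)\<close>, extended by zero.\<close>

section \<open>A bump function with controlled derivatives\<close>

lemma power_le_fact_mult_exp:
  fixes x :: real
  assumes "0 \<le> x"
  shows "x ^ m \<le> fact m * exp x"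
proof -
  have "(\<Sum>n\<in>{m}. inverse (fact n) *\<^sub>R x ^ n) \<le> exp x"
    unfolding exp_def using assms
    by (intro sum_le_suminf summable_exp_generic) (auto simp: divide_simps)
  then show ?thesis
    by (simp add: field_simps)
qed

text \<open>The bump is real analytic inside the interval and flat at both endpoints. Squares in the exponent,
rather than first powers, make its \<open>m\<close>-th derivative grow like \<open>m! ^ (3/2)\<close> up to geometric factors;
with first powers the growth would be like \<open>m!\<^sup>2\<close>. Against coefficients that decay like \<open>1 / (2 * m)!\<close>
this would only just balance, and convergence would depend on the geometric factors.\<close>
definition cbump :: "real \<Rightarrow> complex \<Rightarrow> complex" where
  "cbump T z = exp (- (1 / z\<^sup>2) - 1 / (of_real T - z)\<^sup>2)"

definition bump_deriv :: "real \<Rightarrow> nat \<Rightarrow> real \<Rightarrow> real" where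
  "bump_deriv T m t =
     (if 0 < t \<and> t < T then Re ((deriv ^^ m) (cbump T) (of_real t)) else 0)"

definition bump_bound :: "nat \<Rightarrow> real" where
  "bump_bound m = 10 ^ m * fact m * sqrt (fact m)"

lemma holomorphic_cbump: "cbump T holomorphic_on - {0, of_real T}"
  unfolding cbump_def by (intro holomorphic_intros) auto

text \<open>The derivatives at \<open>t\<close> will be bounded by Cauchy's inequality on a disc whose radius is a tenth of the distance
from \<open>t\<close> to the boundary. On that disc each of the two exponents keeps a negative real part of at least half
the size of its value at the centre.\<close>
lemma Re_inverse_square_ge:
  fixes t :: real and z :: complex
  assumes t: "0 < t" and z: "cmod (z - of_real t) \<le> t / 10"
  shows "1 / (2 * t\<^sup>2) \<le> Re (1 / z\<^sup>2)"
proof -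
  define x y where "x = Re z" and "y = Im z"
  have "\<bar>x - t\<bar> \<le> t / 10" "\<bar>y\<bar> \<le> t / 10"
    using abs_Re_le_cmod[of "z - of_real t"] abs_Im_le_cmod[of "z - of_real t"] z
    by (auto simp: x_def y_def)
  then have x: "9/10 * t \<le> x" "x \<le> 11/10 * t" and y: "\<bar>y\<bar> \<le> t / 10"
    by linarith+
  have y2: "y\<^sup>2 \<le> (t/10)\<^sup>2"
    using power_mono[OF y, of 2] by simp
  have x2: "(9/10 * t)\<^sup>2 \<le> x\<^sup>2" "x\<^sup>2 \<le> (11/10 * t)\<^sup>2"
    using x t by (intro power_mono; simp)+
  \<comment> \<open>\<open>81/100 - 1/100 = 4/5\<close> and \<open>121/100 + 1/100 = 122/100\<close>, with \<open>(122/100)\<^sup>2 \<le> 2 * 4/5\<close>\<close>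
  have num: "4/5 * t\<^sup>2 \<le> x\<^sup>2 - y\<^sup>2"
    using x2 y2 by (simp add: power_mult_distrib power_divide)
  have den: "x\<^sup>2 + y\<^sup>2 \<le> 122/100 * t\<^sup>2" 
    using x2 y2 by (simp add: power_mult_distrib power_divide)
  have pos: "0 < x\<^sup>2 + y\<^sup>2"
    using x t by (intro add_pos_nonneg) auto
  have "Re (1 / z\<^sup>2) = (x\<^sup>2 - y\<^sup>2) / (x\<^sup>2 + y\<^sup>2)\<^sup>2"
  proof -
    have "(Re (z\<^sup>2))\<^sup>2 + (Im (z\<^sup>2))\<^sup>2 = (x\<^sup>2 + y\<^sup>2)\<^sup>2"
      unfolding x_def y_def by (simp add: power2_eq_square algebra_simps)
    then show ?thesis
      by (simp add: Re_divide x_def y_def power2_eq_square)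
  qed
  moreover have "1 / (2 * t\<^sup>2) \<le> (x\<^sup>2 - y\<^sup>2) / (x\<^sup>2 + y\<^sup>2)\<^sup>2"
  proof -
    have "(x\<^sup>2 + y\<^sup>2)\<^sup>2 \<le> (122/100 * t\<^sup>2)\<^sup>2"
      using den pos by (intro power_mono) auto
    also have "\<dots> \<le> 2 * t\<^sup>2 * (4/5 * t\<^sup>2)"
      using t by (simp add: power2_eq_square)
    also have "\<dots> \<le> 2 * t\<^sup>2 * (x\<^sup>2 - y\<^sup>2)"
      using num by (intro mult_left_mono) auto
    finally have "1 / (2 * t\<^sup>2) * (x\<^sup>2 + y\<^sup>2)\<^sup>2 \<le> x\<^sup>2 - y\<^sup>2"
      using t by (simp add: field_simps)
    then show ?thesis
      using pos by (intro mult_imp_le_div_pos) auto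
  qed
  ultimately show ?thesis by simp
qed

lemma bump_deriv_bound_near_boundary:
  assumes t: "0 < t" "t < T" and d: "d = min t (T - t)"
  shows "\<bar>bump_deriv T m t\<bar> \<le> fact m * 10 ^ m * (exp (- (1 / (2 * d\<^sup>2))) / d ^ m)"
proof -
  have dpos: "0 < d" using t d by auto
  have Re_T: "1 / (2 * (T - t)\<^sup>2) \<le> Re (1 / (of_real T - z)\<^sup>2)"
    if "cmod (z - of_real t) \<le> d / 10" for z
  proof (rule Re_inverse_square_ge)
    have "cmod ((of_real T - z) - of_real (T - t)) = cmod (z - of_real t)"
      by (simp add: norm_minus_commute)
    also have "\<dots> \<le> (T - t) / 10" using that d by simp
    finally show "cmod ((of_real T - z) - of_real (T - t)) \<le> (T - t) / 10" .
  qed (use t in auto)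
  have Re_0: "1 / (2 * t\<^sup>2) \<le> Re (1 / z\<^sup>2)" if "cmod (z - of_real t) \<le> d / 10" for z
    using that d t by (intro Re_inverse_square_ge) auto
  have disc: "cball (of_real t) (d / 10) \<subseteq> - {0, complex_of_real T}"
  proof
    fix z assume "z \<in> cball (complex_of_real t) (d / 10)"
    then have "cmod (z - of_real t) \<le> d / 10"
      by (simp add: dist_norm norm_minus_commute)
    then have "0 < Re (1 / z\<^sup>2)" "0 < Re (1 / (of_real T - z)\<^sup>2)"
      using Re_0[of z] Re_T[of z] t by (smt (verit) divide_pos_pos zero_less_power)+
    then show "z \<in> - {0, complex_of_real T}" by auto
  qed
  have bd: "cmod (cbump T z) \<le> exp (- (1 / (2 * d\<^sup>2)))" if "cmod (of_real t - z) = d / 10" for z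
  proof -
    have *: "cmod (z - of_real t) \<le> d / 10" using that by (simp add: norm_minus_commute)
    have "0 \<le> 1 / (2 * t\<^sup>2)" "0 \<le> 1 / (2 * (T - t)\<^sup>2)" by auto
    then have "1 / (2 * d\<^sup>2) \<le> 1 / (2 * t\<^sup>2) + 1 / (2 * (T - t)\<^sup>2)"
      unfolding d min_def by auto
    then show ?thesis
      using Re_0[OF *] Re_T[OF *] unfolding cbump_def norm_exp_eq_Re by simp
  qed
  have "\<bar>bump_deriv T m t\<bar> \<le> cmod ((deriv ^^ m) (cbump T) (of_real t))"
    using t abs_Re_le_cmod by (simp add: bump_deriv_def)
  also have "\<dots> \<le> fact m * exp (- (1 / (2 * d\<^sup>2))) / (d / 10) ^ m"
  proof (rule Cauchy_inequality)
    show "cbump T holomorphic_on ball (of_real t) (d / 10)"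
      using disc ball_subset_cball by (intro holomorphic_on_subset[OF holomorphic_cbump]) blast
    show "continuous_on (cball (of_real t) (d / 10)) (cbump T)"
      using disc by (intro holomorphic_on_imp_continuous_on holomorphic_on_subset[OF holomorphic_cbump])
  qed (use dpos bd in auto)
  also have "\<dots> = fact m * 10 ^ m * (exp (- (1 / (2 * d\<^sup>2))) / d ^ m)"
    using dpos by (simp add: power_divide)
  finally show ?thesis .
qed

text \<open>The flatness at the boundary beats the poles \<open>1 / d ^ m\<close> of Cauchy's inequality at the price of
\<open>sqrt (m!)\<close>: the square of the left-hand side is \<open>x ^ m * exp (- x)\<close> with \<open>x = 1 / d\<^sup>2\<close>.\<close>
lemma exp_over_power_le_sqrt_fact:
  fixes d :: real
  assumes "0 < d"
  shows "exp (- (1 / (2 * d\<^sup>2))) / d ^ m \<le> sqrt (fact m)"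
proof (rule real_le_rsqrt)
  have "(exp (- (1 / (2 * d\<^sup>2))) / d ^ m)\<^sup>2 = exp (- (1 / d\<^sup>2)) * (1 / d\<^sup>2) ^ m"
    using assms by (simp add: power_divide power_mult [symmetric] mult.commute flip: exp_double)
  also have "\<dots> \<le> exp (- (1 / d\<^sup>2)) * (fact m * exp (1 / d\<^sup>2))"
    by (intro mult_left_mono power_le_fact_mult_exp) auto
  also have "\<dots> = fact m"
    by (simp add: exp_minus)
  finally show "(exp (- (1 / (2 * d\<^sup>2))) / d ^ m)\<^sup>2 \<le> fact m" .
qed

lemma bump_deriv_bound: "\<bar>bump_deriv T m t\<bar> \<le> bump_bound m"
proof (cases "0 < t \<and> t < T")
  case True
  define d where "d = min t (T - t)"
  have "\<bar>bump_deriv T m t\<bar> \<le> fact m * 10 ^ m * (exp (- (1 / (2 * d\<^sup>2))) / d ^ m)"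
    using True d_def by (intro bump_deriv_bound_near_boundary) auto
  also have "\<dots> \<le> fact m * 10 ^ m * sqrt (fact m)"
    using True by (intro mult_left_mono exp_over_power_le_sqrt_fact) (auto simp: d_def)
  finally show ?thesis by (simp add: bump_bound_def mult_ac)
qed (auto simp: bump_deriv_def bump_bound_def)

text \<open>Using one power of \<open>d\<close> more than in the uniform bound leaves a factor \<open>d\<close>, so that every derivative
extends continuously by zero.\<close>
lemma bump_deriv_vanishes_at_boundary:
  "\<exists>K\<ge>0. \<forall>t. \<bar>bump_deriv T m t\<bar> \<le> K * \<bar>t\<bar> \<and> \<bar>bump_deriv T m t\<bar> \<le> K * \<bar>T - t\<bar>"
proof (intro exI[of _ "fact m * 10 ^ m * sqrt (fact (Suc m))"] conjI allI)
  fix t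
  let ?K = "fact m * 10 ^ m * sqrt (fact (Suc m)) :: real"
  have "\<bar>bump_deriv T m t\<bar> \<le> ?K * min \<bar>t\<bar> \<bar>T - t\<bar>"
  proof (cases "0 < t \<and> t < T")
    case True
    define d where "d = min t (T - t)"
    have d: "0 < d" using True by (simp add: d_def)
    have "\<bar>bump_deriv T m t\<bar> \<le> fact m * 10 ^ m * (exp (- (1 / (2 * d\<^sup>2))) / d ^ m)"
      using True d_def by (intro bump_deriv_bound_near_boundary) auto
    also have "\<dots> = fact m * 10 ^ m * (exp (- (1 / (2 * d\<^sup>2))) / d ^ Suc m * d)"
      using d by simp
    also have "\<dots> \<le> fact m * 10 ^ m * (sqrt (fact (Suc m)) * d)"
      using d by (intro mult_left_mono mult_right_mono exp_over_power_le_sqrt_fact) auto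
    finally show ?thesis using True by (simp add: d_def mult_ac)
  qed (auto simp: bump_deriv_def)
  then show "\<bar>bump_deriv T m t\<bar> \<le> ?K * \<bar>t\<bar>" "\<bar>bump_deriv T m t\<bar> \<le> ?K * \<bar>T - t\<bar>"
    by (smt (verit, ccfv_SIG) mult_left_mono min.cobounded1 min.cobounded2 fact_ge_zero
        mult_nonneg_nonneg real_sqrt_ge_zero zero_le_power)+
qed auto

lemma bump_deriv_has_derivative:
  assumes "0 < t" "t < T"
  shows "(bump_deriv T m has_real_derivative bump_deriv T (Suc m) t) (at t)"
proof -
  let ?F = "(deriv ^^ m) (cbump T)"
  have "?F holomorphic_on - {0, of_real T}"
    by (intro holomorphic_higher_deriv holomorphic_cbump open_Compl finite_imp_closed) auto
  then have "(?F has_field_derivative deriv ?F (of_real t)) (at (of_real t))"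
    using assms by (intro holomorphic_derivI[of _ "- {0, of_real T}"] open_Compl finite_imp_closed) auto
  then have "((\<lambda>x. ?F (of_real x)) has_vector_derivative deriv ?F (of_real t)) (at t)"
    by (rule has_vector_derivative_real_field)
  then have "((\<lambda>x. Re (?F (of_real x))) has_vector_derivative Re (deriv ?F (of_real t))) (at t)"
    by (rule bounded_linear.has_vector_derivative[OF bounded_linear_Re])
  then have "((\<lambda>x. Re (?F (of_real x))) has_real_derivative bump_deriv T (Suc m) t) (at t)"
    using assms by (simp add: bump_deriv_def has_real_derivative_iff_has_vector_derivative)
  then show ?thesis
    by (rule has_field_derivative_transform_within_open[of _ _ _ "{0<..<T}"])
      (use assms in \<open>auto simp: bump_deriv_def\<close>)
qed

lemma isCont_bump_deriv: "isCont (bump_deriv T m) t"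
proof -
  obtain K where K: "K \<ge> 0" and K0: "\<And>t. \<bar>bump_deriv T m t\<bar> \<le> K * \<bar>t\<bar>"
    and KT: "\<And>t. \<bar>bump_deriv T m t\<bar> \<le> K * \<bar>T - t\<bar>"
    using bump_deriv_vanishes_at_boundary by blast
  consider "t = 0" | "t = T" | "0 < t" "t < T" | "t \<in> {..<0} \<union> {T<..}"
    by fastforce
  then show ?thesis
  proof cases
    case 1
    have "(\<lambda>t. K * \<bar>t\<bar>) \<midarrow>0\<rightarrow> 0"
      by (auto intro!: tendsto_eq_intros)
    then have "bump_deriv T m \<midarrow>0\<rightarrow> 0"
      by (rule Lim_null_comparison[rotated]) (use K0 in simp)
    then show ?thesis using 1 by (simp add: isCont_def bump_deriv_def)
  next
    case 2
    have "(\<lambda>t. K * \<bar>T - t\<bar>) \<midarrow>T\<rightarrow> 0"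
      by (auto intro!: tendsto_eq_intros)
    then have "bump_deriv T m \<midarrow>T\<rightarrow> 0"
      by (rule Lim_null_comparison[rotated]) (use KT in simp)
    then show ?thesis using 2 by (simp add: isCont_def bump_deriv_def)
  next
    case 3
    then show ?thesis using bump_deriv_has_derivative DERIV_isCont by blast
  next
    case 4
    have "isCont (\<lambda>_. 0 :: real) t" by simp
    moreover have "eventually (\<lambda>x. bump_deriv T m x = 0) (nhds t)"
      using 4 by (intro eventually_nhds_in_open[THEN eventually_mono, of "{..<0} \<union> {T<..}"])
        (auto simp: bump_deriv_def)
    ultimately show ?thesis by (subst isCont_cong[of _ "\<lambda>_. 0"]) auto
  qed
qed

lemma continuous_on_bump_deriv: "continuous_on A (bump_deriv T m)"
  using isCont_bump_deriv continuous_at_imp_continuous_on by blast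

section \<open>Laplace transforms of derivatives of the bump\<close>

lemma continuous_lebesgue_on_open_interval:
  fixes f :: "real \<Rightarrow> real"
  assumes "continuous_on {a..b} f"
  shows "integrable (lebesgue_on {a<..<b}) f"
    and "(\<integral>t. f t \<partial>lebesgue_on {a<..<b}) = integral {a..b} f"
proof -
  have "f absolutely_integrable_on {a<..<b}"
    using absolutely_integrable_continuous_real[OF assms]
    by (rule set_integrable_subset) auto
  then show int: "integrable (lebesgue_on {a<..<b}) f"
    by (simp add: integrable_restrict_space set_integrable_def)
  show "(\<integral>t. f t \<partial>lebesgue_on {a<..<b}) = integral {a..b} f"
    by (simp add: lebesgue_integral_eq_integral[OF int] integral_open_interval_real)
qed

definition bump_laplace :: "real \<Rightarrow> real \<Rightarrow> real" where
  "bump_laplace T s = (\<integral>t. exp (- (s * t)) * bump_deriv T 0 t \<partial>lebesgue_on {0<..<T})"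

lemma integrable_exp_bump_deriv:
  "integrable (lebesgue_on {0<..<T}) (\<lambda>t. exp (- (s * t)) * bump_deriv T m t)"
  by (intro continuous_lebesgue_on_open_interval continuous_intros continuous_on_bump_deriv)

text \<open>Integration by parts without boundary terms, since all derivatives of the bump vanish at \<open>0\<close> and \<open>T\<close>:
differentiation becomes multiplication by \<open>s\<close>.\<close>
lemma laplace_bump_deriv:
  assumes "0 < T"
  shows "(\<integral>t. exp (- (s * t)) * bump_deriv T m t \<partial>lebesgue_on {0<..<T}) = s ^ m * bump_laplace T s"
proof (induction m)
  case 0
  then show ?case by (simp add: bump_laplace_def)
next
  case (Suc m)
  let ?f = "\<lambda>m t. exp (- (s * t)) * bump_deriv T m t"
  have cont: "continuous_on {0..T} (?f m)" for m
    by (intro continuous_intros continuous_on_bump_deriv)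
  have "((\<lambda>t. ?f (Suc m) t - s * ?f m t) has_integral (?f m T - ?f m 0)) {0..T}"
  proof (rule fundamental_theorem_of_calculus_interior)
    fix t assume "t \<in> {0<..<T}"
    then have "(?f m has_real_derivative ?f (Suc m) t - s * ?f m t) (at t)"
      by (auto intro!: derivative_eq_intros bump_deriv_has_derivative simp: algebra_simps)
    then show "(?f m has_vector_derivative ?f (Suc m) t - s * ?f m t) (at t)"
      by (simp add: has_real_derivative_iff_has_vector_derivative)
  qed (use assms cont in auto)
  then have "((\<lambda>t. ?f (Suc m) t - s * ?f m t) has_integral 0) {0..T}"
    by (simp add: bump_deriv_def)
  then have "integral {0..T} (\<lambda>t. ?f (Suc m) t - s * ?f m t) = 0"
    by (rule integral_unique)
  moreover have "integral {0..T} (\<lambda>t. ?f (Suc m) t - s * ?f m t)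
      = integral {0..T} (?f (Suc m)) - s * integral {0..T} (?f m)"
    by (subst integral_diff) (auto intro!: integrable_continuous_real continuous_intros continuous_on_bump_deriv)
  ultimately have "integral {0..T} (?f (Suc m)) = s * integral {0..T} (?f m)"
    by simp
  then show ?case
    using Suc by (simp add: continuous_lebesgue_on_open_interval[OF cont])
qed

text \<open>The mass of the bump on the first half of the interval already gives decay no worse than
\<open>exp (- s * T / 2)\<close>. It is decisive that this exponent is smaller than \<open>s * T\<close>: normalising by the
transform at \<open>s = j\<^sup>2\<close> costs \<open>exp (j\<^sup>2 * T)\<close> in the squared norm, against the allowed
\<open>exp (2 * T * j\<^sup>2)\<close>.\<close>
lemma bump_laplace_ge:
  assumes T: "0 < T" and s: "0 \<le> s"
  shows "T / 4 * exp (- 20 / T\<^sup>2) * exp (- (s * T / 2)) \<le> bump_laplace T s"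
proof -
  let ?f = "\<lambda>t. exp (- (s * t)) * bump_deriv T 0 t"
  have cont: "continuous_on {a..b} ?f" for a b
    by (intro continuous_intros continuous_on_bump_deriv)
  have eq: "bump_deriv T 0 t = exp (- (1 / t\<^sup>2) - 1 / (T - t)\<^sup>2)" if "0 < t" "t < T" for t
  proof -
    have "cbump T (of_real t) = of_real (exp (- (1 / t\<^sup>2) - 1 / (T - t)\<^sup>2))"
      by (simp add: cbump_def exp_of_real [symmetric])
    then show ?thesis using that by (simp add: bump_deriv_def)
  qed
  have nonneg: "0 \<le> ?f t" for t
    using eq[of t] by (cases "0 < t \<and> t < T") (auto simp: bump_deriv_def)
  have lower: "exp (- (s * T / 2)) * exp (- 20 / T\<^sup>2) \<le> ?f t" if t: "t \<in> {T/4..T/2}" for t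
  proof -
    have t': "0 < t" "t < T" using t T by auto
    \<comment> \<open>the two exponents contribute \<open>16 / T\<^sup>2\<close> and \<open>4 / T\<^sup>2\<close>\<close>
    have "1 / t\<^sup>2 \<le> 1 / (T/4)\<^sup>2" "1 / (T - t)\<^sup>2 \<le> 1 / (T/2)\<^sup>2"
      using t T by (auto intro!: divide_left_mono power_mono mult_pos_pos)
    then have "- 20 / T\<^sup>2 \<le> - (1 / t\<^sup>2) - 1 / (T - t)\<^sup>2"
      by (simp add: power_divide)
    moreover have "s * t \<le> s * T / 2"
      using t s mult_left_mono[of t "T/2" s] by simp
    ultimately show ?thesis
      unfolding eq[OF t'] by (intro mult_mono) auto
  qed
  have "T / 4 * exp (- 20 / T\<^sup>2) * exp (- (s * T / 2))
      = integral {T/4..T/2} (\<lambda>_. exp (- (s * T / 2)) * exp (- 20 / T\<^sup>2))"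
    using T by simp
  also have "\<dots> \<le> integral {T/4..T/2} ?f"
    by (intro integral_le lower integrable_continuous_real cont continuous_intros)
  also have "\<dots> \<le> integral {0..T} ?f"
    using T nonneg by (intro integral_subset_le integrable_continuous_real cont) auto
  also have "\<dots> = bump_laplace T s"
    by (simp add: bump_laplace_def continuous_lebesgue_on_open_interval[OF cont])
  finally show ?thesis .
qed

text \<open>The differential operator of infinite order with symbol \<open>\<Sum>m. c m * s ^ m\<close>, applied to the bump. Its Laplace
transform is the symbol times the transform of the bump.\<close>
definition bump_series :: "real \<Rightarrow> (nat \<Rightarrow> real) \<Rightarrow> real \<Rightarrow> real" where
  "bump_series T c t = (\<Sum>m. c m * bump_deriv T m t)"

lemma bump_series_term_le: "\<bar>c m * bump_deriv T m t\<bar> \<le> \<bar>c m\<bar> * bump_bound m"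
  unfolding abs_mult by (intro mult_left_mono bump_deriv_bound) auto

lemma
  assumes c: "summable (\<lambda>m. \<bar>c m\<bar> * bump_bound m)"
  shows abs_bump_series_le: "\<bar>bump_series T c t\<bar> \<le> (\<Sum>m. \<bar>c m\<bar> * bump_bound m)"
    and measurable_bump_series:
      "bump_series T c \<in> borel_measurable (lebesgue_on {0<..<T})"
proof -
  have s: "summable (\<lambda>m. \<bar>c m * bump_deriv T m t\<bar>)"
    by (rule summable_comparison_test'[OF c]) (simp add: bump_series_term_le del: abs_mult)
  have "\<bar>bump_series T c t\<bar> \<le> (\<Sum>m. \<bar>c m * bump_deriv T m t\<bar>)"
    unfolding bump_series_def by (rule summable_rabs[OF s])
  also have "\<dots> \<le> (\<Sum>m. \<bar>c m\<bar> * bump_bound m)"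
    using s c by (intro suminf_le bump_series_term_le)
  finally show "\<bar>bump_series T c t\<bar> \<le> (\<Sum>m. \<bar>c m\<bar> * bump_bound m)" .
  have "bump_deriv T m \<in> borel_measurable (lebesgue_on {0<..<T})" for m
    by (intro continuous_imp_measurable_on_sets_lebesgue continuous_on_bump_deriv) auto
  then show "bump_series T c \<in> borel_measurable (lebesgue_on {0<..<T})"
    unfolding bump_series_def by measurable
qed

lemma finite_measure_lebesgue_on_Ioo: "finite_measure (lebesgue_on {a<..<b::real})"
  by (intro finite_measure_lebesgue_on bounded_set_imp_lmeasurable) auto

lemma laplace_bump_series:
  assumes T: "0 < T" and s: "0 \<le> s"
    and c: "summable (\<lambda>m. \<bar>c m\<bar> * bump_bound m)"
  shows "(\<integral>t. exp (- (s * t)) * bump_series T c t \<partial>lebesgue_on {0<..<T})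
         = (\<Sum>m. c m * s ^ m) * bump_laplace T s"
proof -
  let ?M = "lebesgue_on {0<..<T}"
  let ?f = "\<lambda>m t. exp (- (s * t)) * (c m * bump_deriv T m t)"
  interpret finite_measure ?M by (rule finite_measure_lebesgue_on_Ioo)
  have int: "integrable ?M (?f m)" for m
    using integrable_mult_right[OF integrable_exp_bump_deriv[of T s m], of "c m"]
    by (simp add: mult_ac)
  have le: "norm (?f m t) \<le> \<bar>c m\<bar> * bump_bound m" if "t \<in> {0<..<T}" for m t
  proof -
    have "exp (- (s * t)) * \<bar>c m * bump_deriv T m t\<bar> \<le> 1 * (\<bar>c m\<bar> * bump_bound m)"
      using that s by (intro mult_mono bump_series_term_le) auto
    then show ?thesis by (simp add: abs_mult)
  qed
  have "summable (\<lambda>m. \<integral>t. norm (?f m t) \<partial>?M)"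
  proof (rule summable_comparison_test')
    show "summable (\<lambda>m. T * (\<bar>c m\<bar> * bump_bound m))"
      by (intro summable_mult c)
    fix m
    have "(\<integral>t. norm (?f m t) \<partial>?M) \<le> (\<integral>t. \<bar>c m\<bar> * bump_bound m \<partial>?M)"
      using int le by (intro integral_mono) auto
    also have "\<dots> = T * (\<bar>c m\<bar> * bump_bound m)"
      using T by (simp add: measure_restrict_space)
    finally show "norm (\<integral>t. norm (?f m t) \<partial>?M) \<le> T * (\<bar>c m\<bar> * bump_bound m)"
      by simp
  qed
  moreover have "AE t in ?M. summable (\<lambda>m. norm (?f m t))"
    by (intro AE_I2 summable_comparison_test'[OF c]) (use le in auto)
  ultimately have "(\<lambda>m. \<integral>t. ?f m t \<partial>?M) sums (\<integral>t. (\<Sum>m. ?f m t) \<partial>?M)"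
    by (intro sums_integral int)
  moreover have "(\<integral>t. ?f m t \<partial>?M) = c m * s ^ m * bump_laplace T s" for m
  proof -
    have "(\<integral>t. ?f m t \<partial>?M) = (\<integral>t. c m * (exp (- (s * t)) * bump_deriv T m t) \<partial>?M)"
      by (simp only: mult.left_commute)
    then show ?thesis by (simp add: laplace_bump_deriv[OF T])
  qed
  moreover have "(\<Sum>m. ?f m t) = exp (- (s * t)) * bump_series T c t" for t
  proof -
    have "summable (\<lambda>m. c m * bump_deriv T m t)"
      by (rule summable_comparison_test'[OF c]) (use bump_series_term_le in auto)
    then show ?thesis by (simp add: bump_series_def suminf_mult)
  qed
  ultimately have "(\<lambda>m. c m * s ^ m * bump_laplace T s) sums
      (\<integral>t. exp (- (s * t)) * bump_series T c t \<partial>?M)"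
    by simp
  moreover have "bump_laplace T s > 0"
    by (rule less_le_trans[OF _ bump_laplace_ge[OF T s]]) (use T in simp)
  ultimately have "(\<lambda>m. c m * s ^ m) sums
      ((\<integral>t. exp (- (s * t)) * bump_series T c t \<partial>?M) / bump_laplace T s)"
    using sums_divide[of "\<lambda>m. c m * s ^ m * bump_laplace T s" _ "bump_laplace T s"] by simp
  then show ?thesis
    using \<open>bump_laplace T s > 0\<close> by (simp add: sums_iff)
qed

section \<open>An entire function vanishing at all positive squares but one\<close>

lemma summable_power_over_sqrt_fact:
  fixes x :: real
  assumes "0 \<le> x"
  shows "summable (\<lambda>m. x ^ m / sqrt (fact m))"
proof -
  obtain N :: nat where N: "(2 * x)\<^sup>2 \<le> real N"
    using real_arch_simple by blast
  show ?thesis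
  proof (rule summable_ratio_test[of "1/2" N])
    fix n assume "n \<ge> N"
    then have "(2 * x)\<^sup>2 \<le> real (Suc n)" using N by simp
    then have "2 * x \<le> sqrt (real (Suc n))" by (rule real_le_rsqrt)
    then have "x / sqrt (real (Suc n)) \<le> 1/2"
      by (simp add: divide_simps)
    then have "x / sqrt (real (Suc n)) * (x ^ n / sqrt (fact n)) \<le> 1/2 * (x ^ n / sqrt (fact n))"
      using assms by (intro mult_right_mono) auto
    then show "norm (x ^ Suc n / sqrt (fact (Suc n))) \<le> 1/2 * norm (x ^ n / sqrt (fact n))"
      using assms by (simp add: real_sqrt_mult)
  qed auto
qed

lemma even_exp_series:
  fixes x :: real
  assumes "0 \<le> x"
  shows "summable (\<lambda>l. x ^ (2 * l) / fact (2 * l))"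
    and "(\<Sum>l. x ^ (2 * l) / fact (2 * l)) \<le> exp x"
proof -
  have "(\<lambda>n. x ^ n /\<^sub>R fact n) sums exp x"
    by (rule exp_converges)
  then have "(\<lambda>l. \<Sum>n = l * 2..<l * 2 + 2. x ^ n /\<^sub>R fact n) sums exp x"
    by (rule sums_group) simp
  then have g: "(\<lambda>l. x ^ (2 * l) / fact (2 * l) + x ^ Suc (2 * l) / fact (Suc (2 * l))) sums exp x"
  proof (rule back_subst[of "\<lambda>f. f sums exp x"], intro ext)
    fix l
    have "{l * 2..<l * 2 + 2} = {2 * l, Suc (2 * l)}" by auto
    then show "(\<Sum>n = l * 2..<l * 2 + 2. x ^ n /\<^sub>R fact n)
        = x ^ (2 * l) / fact (2 * l) + x ^ Suc (2 * l) / fact (Suc (2 * l))"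
      by (simp add: divide_inverse_commute del: fact_Suc power_Suc)
  qed
  have le: "x ^ (2 * l) / fact (2 * l) \<le> x ^ (2 * l) / fact (2 * l) + x ^ Suc (2 * l) / fact (Suc (2 * l))" for l
    using assms by (intro add_increasing2 divide_nonneg_nonneg) auto
  show s: "summable (\<lambda>l. x ^ (2 * l) / fact (2 * l))"
    by (rule summable_comparison_test'[OF sums_summable[OF g]]) (use le assms in auto)
  show "(\<Sum>l. x ^ (2 * l) / fact (2 * l)) \<le> exp x"
    using suminf_le[OF le s sums_summable[OF g]] g by (simp add: sums_iff)
qed

text \<open>The power series coefficients of \<open>s \<mapsto> sin (pi * sqrt s) / (pi * sqrt s)\<close>, an entire function whose zeros are
exactly the squares of the positive integers.\<close>
definition sinc_coeff :: "nat \<Rightarrow> real" where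
  "sinc_coeff m = (- 1) ^ m * pi ^ (2 * m) / fact (2 * m + 1)"

lemma sinc_coeff_sums_zero:
  assumes "1 \<le> k"
  shows "(\<lambda>m. sinc_coeff m * (real k)\<^sup>2 ^ m) sums 0"
proof -
  have eq: "(- 1) ^ n / (fact (2 * n + 1)) * (pi * real k) ^ (2 * n + 1) / (pi * real k)
      = sinc_coeff n * (real k)\<^sup>2 ^ n" for n
  proof -
    have "(pi * real k) ^ (2 * n + 1) / (pi * real k) = pi ^ (2 * n) * (real k)\<^sup>2 ^ n"
      using assms by (simp add: power_mult_distrib power_mult)
    moreover have "(- 1) ^ n / (fact (2 * n + 1)) * (pi * real k) ^ (2 * n + 1) / (pi * real k)
        = (- 1) ^ n / (fact (2 * n + 1)) * ((pi * real k) ^ (2 * n + 1) / (pi * real k))"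
      by (rule times_divide_eq_right [symmetric])
    ultimately show ?thesis
      by (simp only: sinc_coeff_def times_divide_eq_left mult.assoc)
  qed
  have "(\<lambda>n. (- 1) ^ n / (fact (2 * n + 1)) * (pi * real k) ^ (2 * n + 1)) sums sin (pi * real k)"
    by (rule sin_paired)
  then have "(\<lambda>n. (- 1) ^ n / (fact (2 * n + 1)) * (pi * real k) ^ (2 * n + 1) / (pi * real k)) sums
      (0 / (pi * real k))"
    by (intro sums_divide) (simp add: sin_npi2)
  then show ?thesis
    unfolding eq by simp
qed

text \<open>The derivative of \<open>sin (pi * x) / pi = (\<Sum>m. sinc_coeff m * x ^ (2 * m + 1))\<close> at \<open>x = j\<close>; it will give the
derivative of the sinc series at its zero \<open>j\<^sup>2\<close>.\<close>
lemma sinc_coeff_weighted_sums: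
  "(\<lambda>m. (2 * real m + 1) * sinc_coeff m * (real j)\<^sup>2 ^ m) sums (- 1) ^ j"
proof -
  have "(\<lambda>n. (- 1) ^ n / (fact (2 * n)) * (pi * real j) ^ (2 * n)) sums cos (pi * real j)"
    by (rule cos_paired)
  moreover have "(- 1) ^ n / (fact (2 * n)) * (pi * real j) ^ (2 * n)
      = (2 * real n + 1) * sinc_coeff n * (real j)\<^sup>2 ^ n" for n
  proof -
    have "fact (2 * n + 1) = (2 * real n + 1) * fact (2 * n)" by simp
    moreover have "2 * real n + 1 \<noteq> 0" by (smt (verit) of_nat_0_le_iff)
    ultimately show ?thesis
      unfolding sinc_coeff_def by (simp add: power_mult_distrib power_mult del: fact_Suc)
  qed
  ultimately show ?thesis by simp
qed

text \<open>Dividing the sinc series by \<open>1 - s / j\<^sup>2\<close> removes the zero at \<open>j\<^sup>2\<close> and keeps all others. Formally, the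
coefficients of the quotient are the partial sums of \<open>sinc_coeff i * j ^ (2 * i)\<close> divided by
\<open>j ^ (2 * m)\<close>; since the full sum vanishes, they are also minus the tails divided by
\<open>j ^ (2 * m)\<close>. It is the tails that show the factorial decay of the coefficients.\<close>
definition quotient_coeff :: "nat \<Rightarrow> nat \<Rightarrow> real" where
  "quotient_coeff j m = - (\<Sum>l. sinc_coeff (m + Suc l) * (real j)\<^sup>2 ^ Suc l)"

lemma abs_sinc_coeff_le:
  "\<bar>sinc_coeff (m + l) * (real j)\<^sup>2 ^ l\<bar>
     \<le> pi ^ (2 * m) / fact (2 * m) * ((pi * real j) ^ (2 * l) / fact (2 * l))"
proof -
  have "fact (2 * m) * fact (2 * l) \<le> (fact (2 * m + 2 * l) :: real)"
    using fact_fact_dvd_fact[of "2 * m" "2 * l"] 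
    by (metis dvd_imp_le fact_gt_zero of_nat_fact of_nat_le_iff of_nat_mult)
  also have "\<dots> \<le> fact (2 * (m + l) + 1)"
    by (intro fact_mono) auto
  finally have "pi ^ (2 * (m + l)) * real j ^ (2 * l) / fact (2 * (m + l) + 1)
      \<le> pi ^ (2 * (m + l)) * real j ^ (2 * l) / (fact (2 * m) * fact (2 * l))"
    by (intro divide_left_mono) (auto simp del: fact_Suc)
  then show ?thesis
    by (simp add: sinc_coeff_def abs_mult power_mult_distrib power_add power_mult [symmetric]
        algebra_simps del: fact_Suc)
qed

lemma summable_sinc_tail: "summable (\<lambda>l. sinc_coeff (m + l) * (real j)\<^sup>2 ^ l)"
proof (rule summable_comparison_test')
  show "summable (\<lambda>l. pi ^ (2 * m) / fact (2 * m) * ((pi * real j) ^ (2 * l) / fact (2 * l)))"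
    by (intro summable_mult even_exp_series) auto
qed (use abs_sinc_coeff_le in auto)

lemma quotient_coeff_0:
  assumes "1 \<le> j"
  shows "quotient_coeff j 0 = sinc_coeff 0"
  using suminf_split_head[OF summable_sinc_tail[of 0 j]] sinc_coeff_sums_zero[OF assms]
  by (simp add: quotient_coeff_def sums_iff)

lemma quotient_coeff_Suc:
  assumes "1 \<le> j"
  shows "quotient_coeff j (Suc m) = sinc_coeff (Suc m) + quotient_coeff j m / (real j)\<^sup>2"
proof -
  let ?g = "\<lambda>l. sinc_coeff (Suc m + l) * (real j)\<^sup>2 ^ l"
  have "quotient_coeff j m / (real j)\<^sup>2 = - (\<Sum>l. ?g l)"
    using suminf_mult[OF summable_sinc_tail[of "Suc m" j], of "(real j)\<^sup>2"] assms
    by (simp add: quotient_coeff_def mult_ac)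
  moreover have "quotient_coeff j (Suc m) = - (\<Sum>l. ?g (Suc l))"
    by (simp add: quotient_coeff_def)
  ultimately show ?thesis
    using suminf_split_head[OF summable_sinc_tail[of "Suc m" j]] by simp
qed

text \<open>The dependence on \<open>j\<close> is only exponential, which is negligible against \<open>exp (T * j\<^sup>2)\<close>.\<close>
lemma abs_quotient_coeff_le:
  "\<bar>quotient_coeff j m\<bar> \<le> exp (pi * real j) * (pi\<^sup>2) ^ m / (fact m)\<^sup>2"
proof -
  let ?g = "\<lambda>l. sinc_coeff (m + l) * (real j)\<^sup>2 ^ l"
  let ?h = "\<lambda>l. pi ^ (2 * m) / fact (2 * m) * ((pi * real j) ^ (2 * l) / fact (2 * l))"
  have h: "summable ?h" by (intro summable_mult even_exp_series) auto
  have g: "summable (\<lambda>l. \<bar>?g l\<bar>)"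
    by (rule summable_comparison_test'[OF h]) (use abs_sinc_coeff_le in auto)
  have g': "summable (\<lambda>l. \<bar>?g (Suc l)\<bar>)"
    by (subst summable_Suc_iff) (rule g)
  have "\<bar>quotient_coeff j m\<bar> \<le> (\<Sum>l. \<bar>?g (Suc l)\<bar>)"
    unfolding quotient_coeff_def using summable_rabs[OF g'] by simp
  also have "\<dots> \<le> (\<Sum>l. \<bar>?g l\<bar>)"
    using suminf_split_head[OF g] abs_ge_zero[of "?g 0"] by linarith
  also have "\<dots> \<le> (\<Sum>l. ?h l)"
    by (rule suminf_le[OF abs_sinc_coeff_le g h])
  also have "\<dots> = pi ^ (2 * m) / fact (2 * m) * (\<Sum>l. (pi * real j) ^ (2 * l) / fact (2 * l))"
    by (intro suminf_mult even_exp_series) auto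
  also have "\<dots> \<le> pi ^ (2 * m) / (fact m)\<^sup>2 * exp (pi * real j)"
  proof (intro mult_mono divide_left_mono even_exp_series)
    have "fact m * fact m \<le> (fact (m + m) :: real)"
      using fact_fact_dvd_fact[of m m]
      by (metis dvd_imp_le fact_gt_zero of_nat_fact of_nat_le_iff of_nat_mult)
    then show "(fact m)\<^sup>2 \<le> (fact (2 * m) :: real)"
      by (simp add: power2_eq_square mult_2)
  qed (auto intro!: suminf_nonneg even_exp_series)
  finally show ?thesis unfolding power_mult by (simp add: mult.commute)
qed

lemma summable_quotient_coeff_weighted:
  assumes "0 \<le> x"
  shows "summable (\<lambda>m. \<bar>quotient_coeff j m\<bar> * (x ^ m * fact m * sqrt (fact m)))"
    and "(\<Sum>m. \<bar>quotient_coeff j m\<bar> * (x ^ m * fact m * sqrt (fact m)))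
         \<le> exp (pi * real j) * (\<Sum>m. (pi\<^sup>2 * x) ^ m / sqrt (fact m))"
proof -
  have le: "\<bar>quotient_coeff j m\<bar> * (x ^ m * fact m * sqrt (fact m))
      \<le> exp (pi * real j) * ((pi\<^sup>2 * x) ^ m / sqrt (fact m))" for m
  proof -
    have "\<bar>quotient_coeff j m\<bar> * (x ^ m * fact m * sqrt (fact m))
       \<le> exp (pi * real j) * (pi\<^sup>2) ^ m / (fact m)\<^sup>2 * (x ^ m * fact m * sqrt (fact m))"
      using assms by (intro mult_right_mono abs_quotient_coeff_le) auto
    also have "\<dots> = exp (pi * real j) * ((pi\<^sup>2 * x) ^ m * (sqrt (fact m) / fact m))"
      by (simp add: power_mult_distrib power2_eq_square)
    also have "sqrt (fact m) / fact m = 1 / sqrt (fact m)"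
      by (simp add: field_simps)
    finally show ?thesis by simp
  qed
  have s: "summable (\<lambda>m. (pi\<^sup>2 * x) ^ m / sqrt (fact m))"
    using assms by (intro summable_power_over_sqrt_fact) auto
  show q: "summable (\<lambda>m. \<bar>quotient_coeff j m\<bar> * (x ^ m * fact m * sqrt (fact m)))"
    by (rule summable_comparison_test'[OF summable_mult[OF s, of "exp (pi * real j)"]])
      (use le assms in \<open>auto simp: abs_mult\<close>)
  show "(\<Sum>m. \<bar>quotient_coeff j m\<bar> * (x ^ m * fact m * sqrt (fact m)))
         \<le> exp (pi * real j) * (\<Sum>m. (pi\<^sup>2 * x) ^ m / sqrt (fact m))"
    using suminf_le[OF le q summable_mult[OF s]] suminf_mult[OF s] by simp
qed

lemma summable_quotient_coeff:
  assumes "0 \<le> s"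
  shows "summable (\<lambda>m. quotient_coeff j m * s ^ m)"
    and "summable (\<lambda>m. real m * (quotient_coeff j m * s ^ m))"
proof -
  have one: "1 \<le> fact m * sqrt (fact m :: real)" for m
    using mult_mono[of 1 "fact m" 1 "sqrt (fact m :: real)"] by simp
  show "summable (\<lambda>m. quotient_coeff j m * s ^ m)"
  proof (rule summable_comparison_test'[OF summable_quotient_coeff_weighted(1)[OF assms]])
    fix m
    show "norm (quotient_coeff j m * s ^ m)
        \<le> \<bar>quotient_coeff j m\<bar> * (s ^ m * fact m * sqrt (fact m))"
      using assms mult_left_mono[OF one[of m], of "\<bar>quotient_coeff j m\<bar> * s ^ m"]
      by (simp add: abs_mult mult_ac)
  qed
  have "0 \<le> 2 * s" using assms by simp
  then show "summable (\<lambda>m. real m * (quotient_coeff j m * s ^ m))"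
  proof (rule summable_comparison_test'[OF summable_quotient_coeff_weighted(1)])
    fix m
    have "real m \<le> 2 ^ m"
      by (metis less_exp of_nat_le_iff of_nat_numeral of_nat_power order_less_imp_le)
    then have "real m * 1 \<le> 2 ^ m * (fact m * sqrt (fact m))"
      using one by (intro mult_mono) auto
    then show "norm (real m * (quotient_coeff j m * s ^ m))
        \<le> \<bar>quotient_coeff j m\<bar> * ((2 * s) ^ m * fact m * sqrt (fact m))"
      using assms mult_left_mono[of "real m" "2 ^ m * (fact m * sqrt (fact m))" "\<bar>quotient_coeff j m\<bar> * s ^ m"]
      by (simp add: abs_mult mult_ac power_mult_distrib)
  qed
qed

text \<open>Multiplying the quotient series \<open>C\<close> by \<open>1 - s / j\<^sup>2\<close> returns the sinc series, which vanishes at \<open>s = k\<^sup>2\<close>,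
where the factor \<open>1 - s / j\<^sup>2\<close> does not.\<close>
lemma quotient_series_off_diagonal:
  assumes j: "1 \<le> j" and k: "1 \<le> k" and "k \<noteq> j"
  shows "(\<Sum>m. quotient_coeff j m * (real k)\<^sup>2 ^ m) = 0"
proof -
  let ?s = "(real k)\<^sup>2"
  define q where "q = ?s / (real j)\<^sup>2"
  define C where "C = (\<Sum>m. quotient_coeff j m * ?s ^ m)"
  note sq = summable_quotient_coeff(1)[of ?s j]
  have sa: "(\<lambda>m. sinc_coeff m * ?s ^ m) sums 0"
    by (rule sinc_coeff_sums_zero[OF k])
  have "C - quotient_coeff j 0 = (\<Sum>m. quotient_coeff j (Suc m) * ?s ^ Suc m)"
    using suminf_split_head[OF sq] by (simp add: C_def)
  also have "\<dots> = (\<Sum>m. sinc_coeff (Suc m) * ?s ^ Suc m + q * (quotient_coeff j m * ?s ^ m))"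
    by (simp add: quotient_coeff_Suc[OF j] q_def algebra_simps)
  also have "\<dots> = (\<Sum>m. sinc_coeff (Suc m) * ?s ^ Suc m) + q * C"
    unfolding C_def using sq
    by (subst suminf_add [symmetric])
      (auto intro!: summable_mult simp: suminf_mult summable_Suc_iff[of "\<lambda>m. sinc_coeff m * ?s ^ m"]
         sums_summable[OF sa] simp del: power_Suc)
  also have "(\<Sum>m. sinc_coeff (Suc m) * ?s ^ Suc m) = - sinc_coeff 0"
    using suminf_split_head[OF sums_summable[OF sa]] sa by (simp add: sums_iff)
  finally have "C * (1 - q) = 0"
    by (simp add: quotient_coeff_0[OF j] algebra_simps)
  moreover have "q \<noteq> 1"
    using j \<open>k \<noteq> j\<close> by (simp add: q_def power2_eq_iff_nonneg)
  ultimately show ?thesis by (simp add: C_def)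
qed

text \<open>At \<open>s = j\<^sup>2\<close> the quotient has a removable singularity, and its value there is minus \<open>s\<close> times the derivative of the sinc
series. In terms of \<open>b m = quotient_coeff j m * s ^ m\<close>, the increments of \<open>b\<close> are the terms of the sinc series,
and summation by parts turns \<open>\<Sum>m. b m\<close> into minus the sum of \<open>m\<close> times these increments.\<close>
lemma quotient_series_diagonal:
  assumes j: "1 \<le> j"
  shows "(\<Sum>m. quotient_coeff j m * (real j)\<^sup>2 ^ m) = - ((- 1) ^ j / 2)"
proof -
  let ?s = "(real j)\<^sup>2"
  define b where "b m = quotient_coeff j m * ?s ^ m" for m
  have sb: "summable b" and smb: "summable (\<lambda>m. real m * b m)"
    unfolding b_def using summable_quotient_coeff[of ?s j] by auto
  have sa: "(\<lambda>m. sinc_coeff m * ?s ^ m) sums 0"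
    by (rule sinc_coeff_sums_zero[OF j])
  have "(\<lambda>m. ((2 * real m + 1) * sinc_coeff m * ?s ^ m - sinc_coeff m * ?s ^ m) / 2)
      sums (((- 1) ^ j - 0) / 2)"
    by (intro sums_divide sums_diff sinc_coeff_weighted_sums sa)
  then have sma: "(\<lambda>m. real m * (sinc_coeff m * ?s ^ m)) sums ((- 1) ^ j / 2)"
    by (simp add: algebra_simps)
  have "(\<Sum>m. real m * b m) = (\<Sum>m. real (Suc m) * b (Suc m))"
    using suminf_split_head[OF smb] by simp
  also have "\<dots> = (\<Sum>m. real (Suc m) * (sinc_coeff (Suc m) * ?s ^ Suc m) + (real m * b m + b m))"
    using j by (intro suminf_cong) (simp add: b_def quotient_coeff_Suc[OF j] field_simps)
  also have "\<dots> = (\<Sum>m. real (Suc m) * (sinc_coeff (Suc m) * ?s ^ Suc m)) + ((\<Sum>m. real m * b m) + (\<Sum>m. b m))"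
    using sb smb sums_summable[OF sma]
    by (simp add: suminf_add summable_add
        summable_Suc_iff[of "\<lambda>m. real m * (sinc_coeff m * ?s ^ m)"] del: power_Suc of_nat_Suc)
  also have "(\<Sum>m. real (Suc m) * (sinc_coeff (Suc m) * ?s ^ Suc m)) = (- 1) ^ j / 2"
    using suminf_split_head[OF sums_summable[OF sma]] sma by (simp add: sums_iff)
  finally show ?thesis by (simp add: b_def)
qed

section \<open>A biorthogonal family of moderate growth\<close>

lemma L2_norm_square: "(L2_norm T f)\<^sup>2 = (\<integral>t. (f t)\<^sup>2 \<partial>lebesgue_on {0<..<T})"
  by (simp add: L2_norm_def)

lemma bump_series_quotient_coeff:
  shows "summable (\<lambda>m. \<bar>quotient_coeff j m\<bar> * bump_bound m)"
    and "\<bar>bump_series T (quotient_coeff j) t\<bar>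
           \<le> exp (pi * real j) * (\<Sum>m. (pi\<^sup>2 * 10) ^ m / sqrt (fact m))"
proof -
  have *: "summable (\<lambda>m. \<bar>quotient_coeff j m\<bar> * bump_bound m)"
    "(\<Sum>m. \<bar>quotient_coeff j m\<bar> * bump_bound m)
       \<le> exp (pi * real j) * (\<Sum>m. (pi\<^sup>2 * 10) ^ m / sqrt (fact m))"
    using summable_quotient_coeff_weighted[of 10 j] by (simp_all add: bump_bound_def)
  show "summable (\<lambda>m. \<bar>quotient_coeff j m\<bar> * bump_bound m)" by (rule *(1))
  show "\<bar>bump_series T (quotient_coeff j) t\<bar>
          \<le> exp (pi * real j) * (\<Sum>m. (pi\<^sup>2 * 10) ^ m / sqrt (fact m))"
    using abs_bump_series_le[OF *(1)] *(2) by (rule order_trans)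
qed

text \<open>The operator with symbol \<open>sin (pi * sqrt s) / (pi * sqrt s) / (1 - s / j\<^sup>2)\<close> makes the Laplace transform vanish
at \<open>k\<^sup>2\<close> for all \<open>k \<ge> 1\<close> with \<open>k \<noteq> j\<close>, and the constant \<open>a j\<close> normalises it to \<open>1\<close> at \<open>j\<^sup>2\<close>. The factor
\<open>exp (T * j\<^sup>2)\<close> in the bound comes from the transform of the bump, \<open>exp (2 * pi * j)\<close> from the symbol.\<close>
lemma biorthogonal_family_exists:
  assumes T: "0 < T"
  obtains A \<eta> where "0 < A" "biorthogonal T \<eta>"
    "\<And>j. 1 \<le> j \<Longrightarrow> (L2_norm T (\<eta> j))\<^sup>2 \<le> A * exp (2 * pi * real j + T * (real j)\<^sup>2)"
proof -
  let ?M = "lebesgue_on {0<..<T}"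
  interpret finite_measure ?M by (rule finite_measure_lebesgue_on_Ioo)
  define S where "S = (\<Sum>m. (pi\<^sup>2 * 10) ^ m / sqrt (fact m))"
  define \<delta> where "\<delta> = T / 4 * exp (- 20 / T\<^sup>2)"
  define a where "a j = - (2 * (- 1) ^ j) / bump_laplace T ((real j)\<^sup>2)" for j
  define \<eta> where "\<eta> j t = a j * bump_series T (quotient_coeff j) t" for j t
  have \<delta>: "0 < \<delta>" using T by (simp add: \<delta>_def)
  have H: "\<delta> * exp (- ((real j)\<^sup>2 * T / 2)) \<le> bump_laplace T ((real j)\<^sup>2)" for j
    unfolding \<delta>_def by (rule bump_laplace_ge[OF T]) simp
  have Hpos: "0 < bump_laplace T ((real j)\<^sup>2)" for j
    by (rule less_le_trans[OF _ H]) (use \<delta> in simp)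
  have abs_a: "\<bar>a j\<bar> \<le> 2 / \<delta> * exp ((real j)\<^sup>2 * T / 2)" for j
  proof -
    have "\<bar>a j\<bar> = 2 / bump_laplace T ((real j)\<^sup>2)"
      using Hpos[of j] by (simp add: a_def abs_mult power_abs)
    also have "\<dots> \<le> 2 / (\<delta> * exp (- ((real j)\<^sup>2 * T / 2)))"
      using H[of j] Hpos[of j] \<delta> by (intro divide_left_mono) auto
    finally show ?thesis by (simp add: exp_minus field_simps)
  qed
  have S: "0 \<le> S"
    unfolding S_def by (intro suminf_nonneg summable_power_over_sqrt_fact) auto
  have abs_\<eta>: "\<bar>\<eta> j t\<bar> \<le> 2 * S / \<delta> * exp (pi * real j + (real j)\<^sup>2 * T / 2)" for j t
  proof -
    have "\<bar>\<eta> j t\<bar> \<le> (2 / \<delta> * exp ((real j)\<^sup>2 * T / 2)) * (exp (pi * real j) * S)"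
      unfolding \<eta>_def abs_mult S_def using \<delta>
      by (intro mult_mono abs_a bump_series_quotient_coeff) auto
    then show ?thesis by (simp add: exp_add mult_ac)
  qed
  have sq: "(\<eta> j t)\<^sup>2 \<le> (2 * S / \<delta>)\<^sup>2 * exp (2 * pi * real j + T * (real j)\<^sup>2)" for j t
  proof -
    have "(\<eta> j t)\<^sup>2 \<le> (2 * S / \<delta> * exp (pi * real j + (real j)\<^sup>2 * T / 2))\<^sup>2"
      using power_mono[OF abs_\<eta>[of j t], of 2] by simp
    also have "\<dots> = (2 * S / \<delta>)\<^sup>2 * exp (2 * (pi * real j + (real j)\<^sup>2 * T / 2))"
      by (simp only: power_mult_distrib exp_double)
    finally show ?thesis by (simp add: algebra_simps)
  qed
  have meas: "\<eta> j \<in> borel_measurable ?M" for j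
    unfolding \<eta>_def by (intro borel_measurable_times measurable_bump_series bump_series_quotient_coeff) auto
  have int: "integrable ?M (\<lambda>t. (\<eta> j t)\<^sup>2)" for j
    by (rule integrable_const_bound[where B = "(2 * S / \<delta>)\<^sup>2 * exp (2 * pi * real j + T * (real j)\<^sup>2)"])
      (use sq meas in auto)
  have "biorthogonal T \<eta>"
    unfolding biorthogonal_def L2_def
  proof (intro conjI allI impI, goal_cases)
    case (1 k)
    then show ?case using meas int by simp
  next
    case (2 j k)
    have "(\<integral>t. exp (- ((real j)\<^sup>2 * t)) * \<eta> k t \<partial>?M)
        = (\<integral>t. a k * (exp (- ((real j)\<^sup>2 * t)) * bump_series T (quotient_coeff k) t) \<partial>?M)"
      by (simp only: \<eta>_def mult.left_commute)
    also have "\<dots> = a k * ((\<Sum>m. quotient_coeff k m * (real j)\<^sup>2 ^ m) * bump_laplace T ((real j)\<^sup>2))"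
      by (simp add: laplace_bump_series[OF T] bump_series_quotient_coeff)
    also have "\<dots> = (if j = k then 1 else 0)"
    proof (cases "j = k")
      case True
      then show ?thesis
        using 2 Hpos[of k] quotient_series_diagonal[of k] by (simp add: a_def flip: power_add mult_2)
    next
      case False
      then show ?thesis using 2 quotient_series_off_diagonal[of k j] by simp
    qed
    finally show ?case .
  qed
  moreover have "(L2_norm T (\<eta> j))\<^sup>2 \<le> (T * (2 * S / \<delta>)\<^sup>2 + 1) * exp (2 * pi * real j + T * (real j)\<^sup>2)" for j
  proof -
    let ?E = "exp (2 * pi * real j + T * (real j)\<^sup>2)"
    have "(L2_norm T (\<eta> j))\<^sup>2 \<le> (\<integral>t. (2 * S / \<delta>)\<^sup>2 * ?E \<partial>?M)"
      unfolding L2_norm_square by (intro integral_mono int sq) auto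
    also have "\<dots> = T * ((2 * S / \<delta>)\<^sup>2 * ?E)"
      using T by (simp add: measure_restrict_space)
    also have "\<dots> \<le> (T * (2 * S / \<delta>)\<^sup>2 + 1) * ?E"
      by (simp add: algebra_simps)
    finally show ?thesis .
  qed
  moreover have "0 < T * (2 * S / \<delta>)\<^sup>2 + 1"
    using T by (intro add_nonneg_pos) auto
  ultimately show ?thesis using that by blast
qed

text \<open>Extension by zero: the smallest possible norms do not increase when the time interval grows. Bounds that hold on
a fixed interval are thereby available uniformly for all longer ones.\<close>
lemma extend_biorthogonal:
  assumes a: "0 < a" "a \<le> T" and \<eta>: "biorthogonal a \<eta>"
  obtains \<zeta> where "biorthogonal T \<zeta>" "\<And>j. L2_norm T (\<zeta> j) = L2_norm a (\<eta> j)"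
proof -
  define \<zeta> where "\<zeta> j t = indicator {0<..<a} t * \<eta> j t" for j t
  have eq: "(\<integral>t. f t * \<zeta> j t \<partial>lebesgue_on {0<..<T}) = (\<integral>t. f t * \<eta> j t \<partial>lebesgue_on {0<..<a})" for f j
    using a by (simp add: integral_restrict_space)
      (intro Bochner_Integration.integral_cong, auto simp: \<zeta>_def indicator_def)
  have sq: "indicator {0<..<T} t *\<^sub>R (\<zeta> j t)\<^sup>2 = indicator {0<..<a} t *\<^sub>R (\<eta> j t)\<^sup>2" for j t
    using a by (auto simp: \<zeta>_def indicator_def)
  have norm: "L2_norm T (\<zeta> j) = L2_norm a (\<eta> j)" for j
    by (simp add: L2_norm_def integral_restrict_space sq del: real_scaleR_def)
  have "\<zeta> k \<in> L2 T" if "\<eta> k \<in> L2 a" for k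
    unfolding L2_def
  proof (intro CollectI conjI)
    have "(\<lambda>t. indicator {0<..<a} t *\<^sub>R \<eta> k t) \<in> borel_measurable lebesgue"
      using that by (simp add: L2_def borel_measurable_restrict_space_iff)
    then show "\<zeta> k \<in> borel_measurable (lebesgue_on {0<..<T})"
      unfolding \<zeta>_def by (simp add: measurable_restrict_space1)
    show "integrable (lebesgue_on {0<..<T}) (\<lambda>t. (\<zeta> k t)\<^sup>2)"
      using that by (simp add: L2_def integrable_restrict_space sq del: real_scaleR_def)
  qed
  then have "biorthogonal T \<zeta>"
    using \<eta> by (simp add: biorthogonal_def eq)
  then show ?thesis using norm that by blast
qed

lemma minimal_norm_le:
  assumes "0 < a" "a \<le> T" and "minimal_biorthogonal T \<theta>" and "biorthogonal a \<eta>" and "1 \<le> j"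
  shows "(L2_norm T (\<theta> j))\<^sup>2 \<le> (L2_norm a (\<eta> j))\<^sup>2"
proof -
  obtain \<zeta> where "biorthogonal T \<zeta>" "\<And>j. L2_norm T (\<zeta> j) = L2_norm a (\<eta> j)"
    using extend_biorthogonal assms(1,2,4) by blast
  then have "L2_norm T (\<theta> j) \<le> L2_norm a (\<eta> j)"
    using assms(3,5) by (metis minimal_biorthogonal_def)
  then show ?thesis
    by (rule power_mono) (simp add: L2_norm_def)
qed

lemma norm_bound_constant_pos:
  assumes "0 < L" "L < 1"
  shows "0 < exp 2 * (pi * L - sin (pi * L)) / (128 :: real)"
proof -
  define y where "y = pi * L / 2"
  have y: "0 < y" "y < pi" using assms by (auto simp: y_def field_simps intro: order_less_trans[of _ pi])
  have "sin (2 * y) = 2 * sin y * cos y" by (rule sin_double)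
  also have "\<dots> < 2 * sin y * 1"
    using y sin_gt_zero[of y] cos_monotone_0_pi[of 0 y] by (intro mult_strict_left_mono) auto
  also have "\<dots> \<le> 2 * y"
    using y sin_x_le_x[of y] by simp
  finally show ?thesis by (simp add: y_def)
qed

text \<open>The explicit family grows like \<open>exp (T * j\<^sup>2)\<close> up to a factor exponential in \<open>j\<close>, and the threshold like the
square of that, so the threshold wins for large \<open>j\<close>.\<close>
lemma norm_bound_from_exists:
  assumes L: "0 < L" "L < 1" and T: "0 < T" and \<theta>: "minimal_biorthogonal T \<theta>"
  shows "\<exists>n. norm_bound_from L T \<theta> n"
proof -
  define C where "C = exp 2 * (pi * L - sin (pi * L)) / 128"
  have C: "0 < C" unfolding C_def by (rule norm_bound_constant_pos[OF L])
  obtain A \<eta> where A: "0 < A" and \<eta>: "biorthogonal T \<eta>"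
    and bd: "\<And>j. 1 \<le> j \<Longrightarrow> (L2_norm T (\<eta> j))\<^sup>2 \<le> A * exp (2 * pi * real j + T * (real j)\<^sup>2)"
    using biorthogonal_family_exists[OF T] by blast
  define D where "D = A / C * exp (2 * T)"
  have D: "0 < D" using A C by (simp add: D_def)
  obtain n :: nat where n: "(2 * pi + \<bar>ln D\<bar>) / T \<le> real n"
    using real_arch_simple by blast
  have "(L2_norm T (\<theta> j))\<^sup>2 \<le> C * exp (2 * T * ((real j)\<^sup>2 - 1))" if j: "max 1 n \<le> j" for j
  proof -
    have "(2 * pi + \<bar>ln D\<bar>) / T \<le> real j" using n j by simp
    then have "\<bar>ln D\<bar> \<le> T * real j - 2 * pi"
      using T by (simp add: field_simps)
    then have "1 * \<bar>ln D\<bar> \<le> real j * (T * real j - 2 * pi)"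
      using j by (intro mult_mono) auto
    then have "ln D \<le> T * (real j)\<^sup>2 - 2 * pi * real j"
      by (simp add: power2_eq_square algebra_simps)
    then have "D \<le> exp (T * (real j)\<^sup>2 - 2 * pi * real j)"
      using D by (metis exp_le_cancel_iff exp_ln)
    then have "A * exp (2 * T) \<le> C * exp (T * (real j)\<^sup>2 - 2 * pi * real j)"
      using C by (simp add: D_def field_simps)
    then have "A * exp (2 * T) * exp (2 * pi * real j + T * (real j)\<^sup>2 - 2 * T)
        \<le> C * exp (T * (real j)\<^sup>2 - 2 * pi * real j) * exp (2 * pi * real j + T * (real j)\<^sup>2 - 2 * T)"
      by (intro mult_right_mono) auto
    then have "A * exp (2 * pi * real j + T * (real j)\<^sup>2) \<le> C * exp (2 * T * ((real j)\<^sup>2 - 1))"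
      by (simp add: mult.assoc flip: exp_add) (simp add: algebra_simps)
    moreover have "(L2_norm T (\<theta> j))\<^sup>2 \<le> A * exp (2 * pi * real j + T * (real j)\<^sup>2)"
      using minimal_norm_le[OF T order_refl \<theta> \<eta>, of j] bd[of j] j by simp
    ultimately show ?thesis by simp
  qed
  then have "norm_bound_from L T \<theta> (max 1 n)"
    by (simp add: norm_bound_from_def C_def)
  then show ?thesis by blast
qed

text \<open>For large \<open>T\<close> the family built on the interval \<open>(0, 1)\<close> is used as a competitor: its norms do not depend on \<open>T\<close>,
whereas for \<open>j \<ge> 2\<close> the threshold grows with \<open>T\<close> at least like \<open>exp (6 * T)\<close>. This fails for \<open>j = 1\<close>, where the
threshold is constant.\<close>
lemma norm_bound_from_2:
  assumes L: "0 < L" "L < 1"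
  obtains T0 where "0 < T0" "\<And>T \<theta>. T0 \<le> T \<Longrightarrow> minimal_biorthogonal T \<theta> \<Longrightarrow> norm_bound_from L T \<theta> 2"
proof -
  define C where "C = exp 2 * (pi * L - sin (pi * L)) / 128"
  have C: "0 < C" unfolding C_def by (rule norm_bound_constant_pos[OF L])
  obtain A \<eta> where A: "0 < A" and \<eta>: "biorthogonal 1 \<eta>"
    and bd: "\<And>j. 1 \<le> j \<Longrightarrow> (L2_norm 1 (\<eta> j))\<^sup>2 \<le> A * exp (2 * pi * real j + (real j)\<^sup>2)"
    using biorthogonal_family_exists[of 1] by auto
  define u where "u = \<bar>ln (A / C)\<bar>"
  define T0 where "T0 = (7 + u) / 2"
  have u: "0 \<le> u" by (simp add: u_def)
  have "norm_bound_from L T \<theta> 2" if T: "T0 \<le> T" and \<theta>: "minimal_biorthogonal T \<theta>" for T \<theta>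
  proof -
    have "1 \<le> T"
      using T u by (simp add: T0_def)
    have "(L2_norm T (\<theta> j))\<^sup>2 \<le> C * exp (2 * T * ((real j)\<^sup>2 - 1))" if j: "2 \<le> j" for j
    proof -
      have j2: "4 \<le> (real j)\<^sup>2" using power_mono[of 2 "real j" 2] j by simp
      have "2 * pi * real j \<le> 4 * (real j)\<^sup>2"
      proof -
        have "2 * pi * real j \<le> real j * 4 * real j"
          using pi_less_4 j by (intro mult_right_mono) auto
        then show ?thesis by (simp add: power2_eq_square)
      qed
      \<comment> \<open>\<open>5 * j\<^sup>2 \<le> 7 * (j\<^sup>2 - 1)\<close> as soon as \<open>j\<^sup>2 \<ge> 7/2\<close>; this is where the \<open>7\<close> in \<open>T0\<close> comes from\<close>
      then have e: "2 * pi * real j + (real j)\<^sup>2 \<le> 7 * ((real j)\<^sup>2 - 1)"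
        using j2 by simp
      have "u * 1 \<le> (2 * T - 7) * ((real j)\<^sup>2 - 1)"
        using T j2 u by (intro mult_mono) (auto simp: T0_def)
      then have "ln (A / C) + (2 * pi * real j + (real j)\<^sup>2) \<le> 2 * T * ((real j)\<^sup>2 - 1)"
        using e abs_ge_self[of "ln (A / C)"] unfolding u_def by (simp add: left_diff_distrib)
      then have "exp (ln (A / C)) * exp (2 * pi * real j + (real j)\<^sup>2) \<le> exp (2 * T * ((real j)\<^sup>2 - 1))"
        by (simp flip: exp_add)
      then have "A * exp (2 * pi * real j + (real j)\<^sup>2) \<le> C * exp (2 * T * ((real j)\<^sup>2 - 1))"
        using A C by (simp add: field_simps)
      moreover have "(L2_norm T (\<theta> j))\<^sup>2 \<le> A * exp (2 * pi * real j + (real j)\<^sup>2)"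
        using minimal_norm_le[OF zero_less_one _ \<theta> \<eta>, of j] bd[of j] j \<open>1 \<le> T\<close>
        by simp
      ultimately show ?thesis by simp
    qed
    then show ?thesis by (simp add: norm_bound_from_def C_def)
  qed
  moreover have "0 < T0" using u by (simp add: T0_def)
  ultimately show ?thesis using that by blast
qed

section \<open>Bounds on the terms of the criterion\<close>

text \<open>A function of period \<open>p\<close> runs through \<open>j\<close> full periods on \<open>{0..p}\<close> when its argument is multiplied by \<open>j\<close>, so
its mean does not change. This is why the lower bound on the integrals of \<open>sin\<^sup>2 (j x)\<close> is the same for all \<open>j\<close>.\<close>
lemma integral_periodic_stretch:
  fixes g :: "real \<Rightarrow> real"
  assumes cont: "continuous_on UNIV g" and per: "\<And>x. g (x + p) = g x" and p: "0 < p" and j: "1 \<le> j"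
  shows "integral {0..p} (\<lambda>x. g (real j * x)) = integral {0..p} g"
proof -
  have int: "g integrable_on {a..b}" for a b
    by (intro integrable_continuous_real continuous_on_subset[OF cont]) auto
  have per_n: "g (x + real n * p) = g x" for n x
  proof (induction n)
    case (Suc n)
    then show ?case using per[of "x + real n * p"] by (simp add: algebra_simps)
  qed simp
  have periods: "integral {0..real n * p} g = real n * integral {0..p} g" for n
  proof (induction n)
    case (Suc n)
    have "integral {0..real (Suc n) * p} g
        = integral {0..real n * p} g + integral {real n * p..real (Suc n) * p} g"
      using p by (intro Henstock_Kurzweil_Integration.integral_combine [symmetric] int mult_right_mono) auto
    also have "integral {real n * p..real (Suc n) * p} g = integral {0..p} (\<lambda>x. g (x + real n * p))"
      using integral_shift_real_ivl[of "real n * p" "real n * p" "real (Suc n) * p" g]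
      by (simp add: algebra_simps)
    also have "\<dots> = integral {0..p} g"
      by (simp add: per_n)
    finally show ?case using Suc by (simp add: algebra_simps)
  qed simp
  have img: "(\<lambda>x. x / real j) ` {0..real j * p} = {0..p}"
  proof -
    have "bij_betw (\<lambda>x. x / real j) {0..real j * p} {0..p}"
      by (rule bij_betwI[where g = "\<lambda>x. real j * x"]) (use j in \<open>auto simp: field_simps\<close>)
    then show ?thesis by (rule bij_betw_imp_surj_on)
  qed
  show ?thesis
    using integral_stretch_real[of "real j" 0 "real j * p" g] j by (simp add: img periods)
qed

lemma integral_truncated_sin_square:
  assumes a: "0 \<le> a" "a \<le> pi / 2"
  shows "integral {0..pi} (\<lambda>y. min ((sin y)\<^sup>2 - (sin a)\<^sup>2) 0) = a - sin (2 * a) / 2 - 2 * a * (sin a)\<^sup>2"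
proof -
  let ?c = "(sin a)\<^sup>2"
  let ?g = "\<lambda>y. min ((sin y)\<^sup>2 - ?c) 0"
  define F where "F y = y / 2 - sin (2 * y) / 4 - ?c * y" for y
  have F: "((\<lambda>y. (sin y)\<^sup>2 - ?c) has_integral F v - F u) {u..v}" if "u \<le> v" for u v
  proof (rule fundamental_theorem_of_calculus[OF that])
    fix y
    have "(F has_real_derivative 1 / 2 - cos (2 * y) / 2 - ?c) (at y within {u..v})"
      unfolding F_def by (auto intro!: derivative_eq_intros)
    moreover have "1 / 2 - cos (2 * y) / 2 - ?c = (sin y)\<^sup>2 - ?c"
      unfolding cos_double_sin by (simp add: field_simps)
    ultimately show "(F has_vector_derivative (sin y)\<^sup>2 - ?c) (at y within {u..v})"
      by (simp add: has_real_derivative_iff_has_vector_derivative)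
  qed
  have sin_le: "(sin y)\<^sup>2 \<le> ?c" if "0 \<le> y" "y \<le> a" for y
    using that a by (intro power_mono sin_monotone_2pi_le sin_ge_zero) auto
  have sin_ge: "?c \<le> (sin y)\<^sup>2" if "a \<le> y" "y \<le> pi - a" for y
  proof (cases "y \<le> pi / 2")
    case True
    then show ?thesis using that a by (intro power_mono sin_monotone_2pi_le sin_ge_zero) auto
  next
    case False
    have "?c \<le> (sin (pi - y))\<^sup>2"
      using that a False by (intro power_mono sin_monotone_2pi_le sin_ge_zero) auto
    then show ?thesis by simp
  qed
  have 1: "(?g has_integral F a - F 0) {0..a}"
    using F[OF a(1)] by (rule has_integral_eq[rotated]) (use sin_le in \<open>auto simp: min_def\<close>)
  have 2: "(?g has_integral 0) {a..pi - a}"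
  proof (rule has_integral_is_0)
    fix y assume "y \<in> {a..pi - a}"
    then have "?c \<le> (sin y)\<^sup>2" by (intro sin_ge) auto
    then show "?g y = 0" by simp
  qed
  have 3: "(?g has_integral F pi - F (pi - a)) {pi - a..pi}"
  proof (rule has_integral_eq)
    show "((\<lambda>y. (sin y)\<^sup>2 - ?c) has_integral F pi - F (pi - a)) {pi - a..pi}"
      by (rule F) (use a in simp)
    fix y assume "y \<in> {pi - a..pi}"
    then have "(sin (pi - y))\<^sup>2 \<le> ?c" by (intro sin_le) auto
    then show "(sin y)\<^sup>2 - ?c = ?g y" by (simp add: min_def)
  qed
  have "(?g has_integral (F a - F 0 + 0)) {0..pi - a}"
    using a by (intro has_integral_combine[OF _ _ 1 2]) auto
  then have "(?g has_integral (F a - F 0 + 0 + (F pi - F (pi - a)))) {0..pi}"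
    using a by (intro has_integral_combine[OF _ _ _ 3]) auto
  then have "integral {0..pi} ?g = F a - F 0 + (F pi - F (pi - a))"
    by (simp add: integral_unique)
  also have "\<dots> = a - sin (2 * a) / 2 - 2 * a * ?c"
  proof -
    have "sin (2 * (pi - a)) = - sin (2 * a)"
      by (simp add: right_diff_distrib sin_diff)
    then show ?thesis by (simp add: F_def field_simps)
  qed
  finally show ?thesis .
qed

lemma set_integrable_continuous_admissible:
  fixes f :: "real \<Rightarrow> real"
  assumes "continuous_on UNIV f" and "\<omega> \<in> admissible L"
  shows "set_integrable lebesgue \<omega> f"
proof -
  have "set_integrable lebesgue {0..pi} f"
    by (intro absolutely_integrable_continuous_real continuous_on_subset[OF assms(1)]) auto
  then show ?thesis
    by (rule set_integrable_subset) (use assms(2) in \<open>auto simp: admissible_def\<close>)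
qed

lemma set_integral_const_admissible:
  assumes "\<omega> \<in> admissible L"
  shows "(\<integral>x\<in>\<omega>. c \<partial>lebesgue) = L * pi * c"
proof -
  have sub: "\<omega> \<subseteq> {0..pi}" and sets: "\<omega> \<in> sets lebesgue" and meas: "measure lebesgue \<omega> = L * pi"
    using assms by (auto simp: admissible_def)
  have "\<omega> \<in> lmeasurable"
    using bounded_subset[OF bounded_closed_interval sub] sets by (rule bounded_set_imp_lmeasurable)
  then have fin: "emeasure lebesgue \<omega> < \<infinity>"
    by (metis fmeasurableD2 infinity_ennreal_def less_top)
  have "(\<integral>x\<in>\<omega>. c \<partial>lebesgue) = (\<integral>x. indicator \<omega> x * c \<partial>lebesgue)"
    by (simp add: set_lebesgue_integral_def)
  also have "\<dots> = measure lebesgue \<omega> * c"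
    using fin sets by simp
  finally show ?thesis by (simp add: meas)
qed

text \<open>The bathtub principle: among sets of measure \<open>L * pi\<close> the integral is smallest on a sublevel set of
\<open>sin\<^sup>2 (j x)\<close>. The level \<open>c = sin\<^sup>2 (pi * L / 2)\<close> is the one whose sublevel set has measure \<open>L * pi\<close>, so the
bound is sharp. The comparison itself is pointwise: on \<open>\<omega>\<close> the integrand minus \<open>c\<close> is at least its negative part,
and extending the integral of the negative part to the whole interval only decreases it.\<close>
lemma sin_square_integral_lower_bound:
  assumes L: "0 < L" "L < 1" and \<omega>: "\<omega> \<in> admissible L" and j: "1 \<le> j"
  shows "(pi * L - sin (pi * L)) / 2 \<le> (\<integral>x\<in>\<omega>. (sin (real j * x))\<^sup>2 \<partial>lebesgue)"
proof -
  define a where "a = pi * L / 2"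
  let ?c = "(sin a)\<^sup>2"
  let ?g = "\<lambda>y. min ((sin y)\<^sup>2 - ?c) 0"
  have a: "0 \<le> a" "a \<le> pi / 2" using L by (auto simp: a_def)
  have cont: "continuous_on UNIV (\<lambda>x. ?g (real j * x))"
    by (intro continuous_intros)
  have g_int: "set_integrable lebesgue {0..pi} (\<lambda>x. ?g (real j * x))"
    by (intro absolutely_integrable_continuous_real continuous_on_subset[OF cont]) auto
  have sin_int: "set_integrable lebesgue \<omega> (\<lambda>x. (sin (real j * x))\<^sup>2)"
    and diff_int: "set_integrable lebesgue \<omega> (\<lambda>x. (sin (real j * x))\<^sup>2 - ?c)"
    and c_int: "set_integrable lebesgue \<omega> (\<lambda>x. ?c)"
    by (intro set_integrable_continuous_admissible[OF _ \<omega>] continuous_intros)+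
  have "a - sin (2 * a) / 2 - 2 * a * ?c = integral {0..pi} ?g"
    by (rule integral_truncated_sin_square[OF a, symmetric])
  also have "\<dots> = integral {0..pi} (\<lambda>x. ?g (real j * x))"
    by (rule integral_periodic_stretch[OF _ _ _ j, symmetric]) (auto intro!: continuous_intros)
  also have "\<dots> = (\<integral>x\<in>{0..pi}. ?g (real j * x) \<partial>lebesgue)"
    by (rule set_lebesgue_integral_eq_integral(2)[OF g_int, symmetric])
  also have "\<dots> \<le> (\<integral>x\<in>\<omega>. ((sin (real j * x))\<^sup>2 - ?c) \<partial>lebesgue)"
    unfolding set_lebesgue_integral_def
  proof (rule integral_mono)
    fix x :: real
    have "\<omega> \<subseteq> {0..pi}" using \<omega> by (auto simp: admissible_def)
    then show "indicator {0..pi} x *\<^sub>R ?g (real j * x) \<le> indicator \<omega> x *\<^sub>R ((sin (real j * x))\<^sup>2 - ?c)"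
      by (auto simp: indicator_def)
  qed (use g_int diff_int in \<open>auto simp: set_integrable_def\<close>)
  also have "\<dots> = (\<integral>x\<in>\<omega>. (sin (real j * x))\<^sup>2 \<partial>lebesgue) - L * pi * ?c"
    using set_integral_diff(2)[OF sin_int c_int] set_integral_const_admissible[OF \<omega>] by simp
  finally show ?thesis
    by (simp add: a_def algebra_simps)
qed

lemma sin_square_integral_upper_bound:
  assumes \<omega>: "\<omega> \<in> admissible L"
  shows "(\<integral>x\<in>\<omega>. (sin (real j * x))\<^sup>2 \<partial>lebesgue) \<le> L * pi"
proof -
  have "(\<integral>x\<in>\<omega>. (sin (real j * x))\<^sup>2 \<partial>lebesgue) \<le> (\<integral>x\<in>\<omega>. 1 \<partial>lebesgue)"
    by (intro set_integral_mono set_integrable_continuous_admissible[OF _ \<omega>] continuous_intros)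
      (simp add: abs_square_le_1)
  then show ?thesis using set_integral_const_admissible[OF \<omega>, of 1] by simp
qed

text \<open>Biorthogonality makes the inner product of \<open>\<theta> j\<close> with the exponential equal to \<open>1\<close>, so the norm cannot be
small: \<open>2 = 2 \<langle>e, \<theta> j\<rangle> \<le> \<parallel>e\<parallel>\<^sup>2 + \<parallel>\<theta> j\<parallel>\<^sup>2\<close> and \<open>\<parallel>e\<parallel>\<^sup>2 \<le> 1 / 2\<close>.\<close>
lemma biorthogonal_norm_lower_bound:
  assumes T: "0 < T" and \<theta>: "biorthogonal T \<theta>" and j: "1 \<le> j"
  shows "3 / 2 \<le> (\<integral>t. (\<theta> j t)\<^sup>2 \<partial>lebesgue_on {0<..<T})"
proof -
  let ?M = "lebesgue_on {0<..<T}"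
  let ?e = "\<lambda>t. exp (- ((real j)\<^sup>2 * t))"
  have one: "(\<integral>t. ?e t * \<theta> j t \<partial>?M) = 1" and sq: "integrable ?M (\<lambda>t. (\<theta> j t)\<^sup>2)"
    using \<theta> j by (auto simp: biorthogonal_def L2_def)
  \<comment> \<open>The integral of a non-integrable function is \<open>0\<close> by convention, but here it is \<open>1\<close>.\<close>
  have int: "integrable ?M (\<lambda>t. ?e t * \<theta> j t)"
    using one not_integrable_integral_eq by fastforce
  have cont: "continuous_on {0..T} (\<lambda>t. exp (- 2 * t))" by (intro continuous_intros)
  have "((\<lambda>t. exp (- 2 * t)) has_integral (- exp (- 2 * T) / 2 - - exp (- 2 * 0) / 2)) {0..T}"
    using T by (intro fundamental_theorem_of_calculus)
      (auto intro!: derivative_eq_intros simp flip: has_real_derivative_iff_has_vector_derivative)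
  then have e2: "(\<integral>t. exp (- 2 * t) \<partial>?M) \<le> 1 / 2"
    unfolding continuous_lebesgue_on_open_interval(2)[OF cont] by (simp add: integral_unique)
  have "2 = (\<integral>t. 2 * (?e t * \<theta> j t) \<partial>?M)"
    using one by simp
  also have "\<dots> \<le> (\<integral>t. exp (- 2 * t) + (\<theta> j t)\<^sup>2 \<partial>?M)"
  proof (rule integral_mono)
    show "integrable ?M (\<lambda>t. exp (- 2 * t) + (\<theta> j t)\<^sup>2)"
      by (intro Bochner_Integration.integrable_add sq continuous_lebesgue_on_open_interval(1)[OF cont])
    fix t assume "t \<in> space ?M"
    then have t: "0 \<le> t" by simp
    have "1 \<le> (real j)\<^sup>2" using j by (simp add: one_le_power)
    then have "1 * t \<le> (real j)\<^sup>2 * t" using t by (rule mult_right_mono)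
    then have "(?e t)\<^sup>2 \<le> exp (- 2 * t)"
      by (simp flip: exp_double)
    moreover have "2 * (?e t * \<theta> j t) \<le> (?e t)\<^sup>2 + (\<theta> j t)\<^sup>2"
      using sum_squares_bound[of "?e t" "\<theta> j t"] by simp
    ultimately show "2 * (?e t * \<theta> j t) \<le> exp (- 2 * t) + (\<theta> j t)\<^sup>2" by simp
  qed (use int in simp)
  also have "\<dots> = (\<integral>t. exp (- 2 * t) \<partial>?M) + (\<integral>t. (\<theta> j t)\<^sup>2 \<partial>?M)"
    by (intro Bochner_Integration.integral_add sq continuous_lebesgue_on_open_interval(1)[OF cont])
  finally show ?thesis using e2 by simp
qed

section \<open>Truncation of the criterion\<close>

definition weighted_energy :: "real \<Rightarrow> (nat \<Rightarrow> real \<Rightarrow> real) \<Rightarrow> real set \<Rightarrow> nat \<Rightarrow> real" where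
  "weighted_energy T \<theta> \<omega> j =
     exp (2 * (real j)\<^sup>2 * T) / (\<integral>t. (\<theta> j t)\<^sup>2 \<partial>lebesgue_on {0<..<T})
       * (\<integral>x\<in>\<omega>. (sin (real j * x))\<^sup>2 \<partial>lebesgue)"

lemma criterion_eq: "criterion T \<theta> I \<omega> = (INF j\<in>I. weighted_energy T \<theta> \<omega> j)"
  by (simp add: criterion_def weighted_energy_def)

lemma weighted_energy_nonneg: "0 \<le> weighted_energy T \<theta> \<omega> j"
  by (simp add: weighted_energy_def set_lebesgue_integral_def)

text \<open>Where the norm bound holds, the weight of index \<open>j\<close> times the smallest possible integral is at least
\<open>(64 / e\<^sup>2) * e ^ (2 T)\<close>, whereas the term of index \<open>1\<close> is at most \<open>(8 / 3) * e ^ (2 T)\<close> because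
\<open>\<parallel>\<theta> 1\<parallel>\<^sup>2 \<ge> 3 / 2\<close> and the integral is at most \<open>pi < 4\<close>.\<close>
lemma weighted_energy_1_le:
  assumes L: "0 < L" "L < 1" and T: "0 < T" and \<theta>: "biorthogonal T \<theta>"
    and n: "norm_bound_from L T \<theta> n" and \<omega>: "\<omega> \<in> admissible L" and j: "n \<le> j"
  shows "weighted_energy T \<theta> \<omega> 1 \<le> weighted_energy T \<theta> \<omega> j"
proof -
  define D where "D = pi * L - sin (pi * L)"
  define N where "N i = (\<integral>t. (\<theta> i t)\<^sup>2 \<partial>lebesgue_on {0<..<T})" for i
  define J where "J i = (\<integral>x\<in>\<omega>. (sin (real i * x))\<^sup>2 \<partial>lebesgue)" for i
  have j1: "1 \<le> j" using n j by (simp add: norm_bound_from_def)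
  have D: "0 < D" using norm_bound_constant_pos[OF L] by (simp add: D_def zero_less_mult_iff)
  have N1: "3 / 2 \<le> N 1" and Nj: "3 / 2 \<le> N j"
    using biorthogonal_norm_lower_bound[OF T \<theta>] j1 by (auto simp: N_def)
  have "N j \<le> exp 2 * D / 128 * exp (2 * T * ((real j)\<^sup>2 - 1))"
    using n j by (simp add: norm_bound_from_def L2_norm_square N_def D_def)
  have J1: "J 1 \<le> 4"
  proof -
    have "L * pi \<le> 1 * 4" using L pi_less_4 by (intro mult_mono) auto
    then show ?thesis
      using sin_square_integral_upper_bound[OF \<omega>, of 1] by (simp add: J_def)
  qed
  have Jj: "D / 2 \<le> J j"
    using sin_square_integral_lower_bound[OF L \<omega> j1] by (simp add: J_def D_def)
  have exp_2: "exp (2::real) \<le> 9"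
    using power_mono[OF exp_le, of 2] by (simp flip: exp_double)
  have "weighted_energy T \<theta> \<omega> 1 = exp (2 * T) * (J 1 / N 1)"
    by (simp add: weighted_energy_def J_def N_def)
  also have "J 1 / N 1 \<le> 4 / (3 / 2)"
    using J1 N1 by (intro frac_le) auto
  also have "4 / (3 / 2) \<le> 64 / exp (2::real)"
    using exp_2 by (simp add: field_simps)
  also have "exp (2 * T) * (64 / exp 2)
      = exp (2 * (real j)\<^sup>2 * T) / (exp 2 * D / 128 * exp (2 * T * ((real j)\<^sup>2 - 1))) * (D / 2)"
  proof -
    have "exp (2 * (real j)\<^sup>2 * T) = exp (2 * T) * exp (2 * T * ((real j)\<^sup>2 - 1))"
      by (simp add: algebra_simps flip: exp_add)
    then show ?thesis using D by (simp add: field_simps)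
  qed
  also have "\<dots> \<le> exp (2 * (real j)\<^sup>2 * T) / N j * J j"
    using \<open>N j \<le> _\<close> Jj Nj D by (intro mult_mono divide_left_mono) auto
  also have "\<dots> = weighted_energy T \<theta> \<omega> j"
    by (simp add: weighted_energy_def J_def N_def)
  finally show ?thesis by simp
qed

lemma criterion_truncation:
  assumes N: "1 \<le> N" and tail: "\<And>j. N < j \<Longrightarrow> weighted_energy T \<theta> \<omega> 1 \<le> weighted_energy T \<theta> \<omega> j"
  shows "criterion T \<theta> {1..N} \<omega> = criterion T \<theta> {1..} \<omega>"
proof (rule antisym)
  have bdd: "bdd_below (weighted_energy T \<theta> \<omega> ` I)" for I
    by (rule bdd_belowI2[of _ 0]) (rule weighted_energy_nonneg)
  show "criterion T \<theta> {1..N} \<omega> \<le> criterion T \<theta> {1..} \<omega>"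
    unfolding criterion_eq
  proof (rule cINF_mono)
    fix j :: nat assume j: "j \<in> {1..}"
    show "\<exists>i\<in>{1..N}. weighted_energy T \<theta> \<omega> i \<le> weighted_energy T \<theta> \<omega> j"
    proof (cases "j \<le> N")
      case True
      then show ?thesis using j by (intro bexI[of _ j]) auto
    next
      case False
      then show ?thesis using tail[of j] N by (intro bexI[of _ 1]) auto
    qed
  qed (use bdd in auto)
  show "criterion T \<theta> {1..} \<omega> \<le> criterion T \<theta> {1..N} \<omega>"
    unfolding criterion_eq using N bdd by (intro cINF_superset_mono) auto
qed

text \<open>When the tail never undercuts the first term, the truncated and the full criterion are the same function on
the admissible sets. Then the full maximiser also solves the truncated problem, and uniqueness identifies the two.\<close>
lemma truncated_solution_eq:
  assumes N: "1 \<le> N"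
    and tail: "\<And>\<omega> j. \<omega> \<in> admissible L \<Longrightarrow> N < j \<Longrightarrow>
       weighted_energy T \<theta> \<omega> 1 \<le> weighted_energy T \<theta> \<omega> j"
    and star: "unique_solution L T \<theta> {1..} \<omega>_star" and trunc: "unique_solution L T \<theta> {1..N} \<omega>_N"
  shows "ae_eq \<omega>_star \<omega>_N"
proof -
  have eq: "criterion T \<theta> {1..N} \<omega> = criterion T \<theta> {1..} \<omega>" if "\<omega> \<in> admissible L" for \<omega>
    using N tail[OF that] by (rule criterion_truncation)
  then have "(SUP \<omega>\<in>admissible L. criterion T \<theta> {1..N} \<omega>) = (SUP \<omega>\<in>admissible L. criterion T \<theta> {1..} \<omega>)"
    by (intro SUP_cong refl)
  moreover have "\<omega>_star \<in> admissible L"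
    "criterion T \<theta> {1..} \<omega>_star = (SUP \<omega>\<in>admissible L. criterion T \<theta> {1..} \<omega>)"
    using star by (auto simp: unique_solution_def solution_def)
  ultimately have "solution L T \<theta> {1..N} \<omega>_star"
    unfolding solution_def by (metis eq)
  then show ?thesis using trunc by (simp add: unique_solution_def)
qed

theorem theorem2:
  fixes L :: real
  assumes "0 < L" and "L < 1"
  shows
    "(\<forall>T>0. \<forall>\<theta> \<omega>_star \<omega>_trunc.
        biorthogonal T \<theta> \<longrightarrow>
        unique_solution L T \<theta> {1..} \<omega>_star \<longrightarrow>
        (\<forall>N\<ge>1. unique_solution L T \<theta> {1..N} (\<omega>_trunc N)) \<longrightarrow>
        (\<exists>n. norm_bound_from L T \<theta> n) \<longrightarrow>
        (\<exists>N0\<ge>1. (\<forall>N\<ge>N0. ae_eq \<omega>_star (\<omega>_trunc N)) \<and>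
                 N0 \<le> (LEAST n. norm_bound_from L T \<theta> n)))
     \<and> (\<forall>T>0. \<forall>\<theta>. minimal_biorthogonal T \<theta> \<longrightarrow> (\<exists>n. norm_bound_from L T \<theta> n))
     \<and> (\<exists>T0>0. \<forall>T\<ge>T0. \<forall>\<theta> \<omega>_star \<omega>_trunc.
        minimal_biorthogonal T \<theta> \<longrightarrow>
        unique_solution L T \<theta> {1..} \<omega>_star \<longrightarrow>
        (\<forall>N\<ge>1. unique_solution L T \<theta> {1..N} (\<omega>_trunc N)) \<longrightarrow>
        (\<forall>N\<ge>1. ae_eq \<omega>_star (\<omega>_trunc N)))"
proof (intro conjI allI impI, goal_cases)
  case (1 T \<theta> \<omega>_star \<omega>_trunc)
  define n where "n = (LEAST n. norm_bound_from L T \<theta> n)"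
  have n: "norm_bound_from L T \<theta> n"
    using 1(5) unfolding n_def by (rule LeastI_ex)
  \<comment> \<open>The threshold itself serves as \<open>N0\<close>.\<close>
  then have "1 \<le> n" by (simp add: norm_bound_from_def)
  moreover have "ae_eq \<omega>_star (\<omega>_trunc N)" if "n \<le> N" for N
  proof (rule truncated_solution_eq[where N = N])
    fix \<omega> j assume "\<omega> \<in> admissible L" "N < j"
    then show "weighted_energy T \<theta> \<omega> 1 \<le> weighted_energy T \<theta> \<omega> j"
      using that assms 1(1,2) n by (intro weighted_energy_1_le) auto
  qed (use 1 that \<open>1 \<le> n\<close> in auto)
  ultimately show ?case unfolding n_def by blast
next
  case (2 T \<theta>)
  then show ?case using norm_bound_from_exists assms by blast
next
  case 3
  obtain T0 where T0: "0 < T0"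
    and bound: "\<And>T \<theta>. T0 \<le> T \<Longrightarrow> minimal_biorthogonal T \<theta> \<Longrightarrow> norm_bound_from L T \<theta> 2"
    using norm_bound_from_2 assms by blast
  show ?case
  proof (intro exI[of _ T0] conjI allI impI T0)
    fix T \<theta> \<omega>_star \<omega>_trunc and N :: nat
    assume T: "T0 \<le> T" and \<theta>: "minimal_biorthogonal T \<theta>"
      and star: "unique_solution L T \<theta> {1..} \<omega>_star"
      and trunc: "\<forall>N\<ge>1. unique_solution L T \<theta> {1..N} (\<omega>_trunc N)" and N: "1 \<le> N"
    show "ae_eq \<omega>_star (\<omega>_trunc N)"
    \<comment> \<open>A threshold of \<open>2\<close> suffices for all \<open>N \<ge> 1\<close>, since only the indices beyond \<open>N\<close> are discarded.\<close>
    proof (rule truncated_solution_eq[OF N _ star])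
      fix \<omega> j assume "\<omega> \<in> admissible L" "N < j"
      then show "weighted_energy T \<theta> \<omega> 1 \<le> weighted_energy T \<theta> \<omega> j"
        using N T T0 \<theta> assms bound[OF T \<theta>]
        by (intro weighted_energy_1_le[where n = 2]) (auto simp: minimal_biorthogonal_def)
    qed (use trunc N in auto)
  qed
qed

end
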